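(* Let $\rho>0$, let $c$ be a real constant, and let $\alpha$ be an irrational real number. Let $h$ be an entire function of minimal exponential type, and put $$c_n=h(0)h(1)\cdots h(n),\qquad n\ge 0.$$ Assume in addition that $$-\log|c_n|=\frac1\rho\, n\log n-cn+o(n),\qquad n\to\infty .$$ Then the entire function $$f(z)=\sum_{n=0}^\infty c_n e^{2\pi i n^2\alpha}z^n$$ has order $\rho$, normal type, and completely regular growth (with respect to order $\rho$) with constant indicator.
   Context: An entire function $h$ is of minimal exponential type if $\limsup_{|z|\to\infty}|z|^{-1}\log|h(z)|\le 0$. An entire function $f$ of order $\rho$ has normal type if $0<\limsup_{r\to\infty}r^{-\rho}\log\max_{|z|=r}|f(z)|<\infty$. An entire function $f$ of order $\rho$, normal type, is of completely regular growth (in the sense of Levin–Pfluger) if the limit $u=\lim_{t\to\infty}t^{-\rho}\log|f(tz)|$ exists in the space $D'$ of Schwartz distributions in the plane (as functions of $z$). The indicator of such $f$ is $h_f(\theta)=\limsup_{r\to\infty}r^{-\rho}\log|f(re^{i\theta})|$; "constant indicator" means that $h_f(\theta)$ does not depend on $\theta$. *)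

theory Defs
  imports "HOL-Complex_Analysis.Complex_Analysis" "HOL-Library.Landau_Symbols"
begin

text \<open>Logarithm of a nonnegative real with \<open>log 0 = -\<infinity>\<close>, needed because \<^term>\<open>ln (0::real) = 0\<close>.\<close>

definition log_ereal :: "real \<Rightarrow> ereal" where
  "log_ereal x = (if x = 0 then -\<infinity> else ereal (ln x))"


section \<open>Growth of entire functions\<close>

definition minimal_exponential_type :: "(complex \<Rightarrow> complex) \<Rightarrow> bool" where
  "minimal_exponential_type h \<longleftrightarrow> h holomorphic_on UNIV \<and>
     Limsup at_infinity (\<lambda>z. ereal (1 / cmod z) * log_ereal (cmod (h z))) \<le> 0"

definition max_modulus :: "(complex \<Rightarrow> complex) \<Rightarrow> real \<Rightarrow> real" where
  "max_modulus f r = (SUP z\<in>sphere 0 r. cmod (f z))"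

text \<open>\<open>limsup log log M(r) / log r\<close>.  The truncations \<open>max 1\<close> (that is, \<open>log\<^sup>+\<close>) only serve to
  make the iterated logarithm meaningful; they are inactive for large \<open>r\<close> unless \<open>f\<close> is
  constant, and constants get order 0.\<close>

definition entire_order :: "(complex \<Rightarrow> complex) \<Rightarrow> ereal" where
  "entire_order f =
     Limsup at_top (\<lambda>r. ereal (ln (max 1 (ln (max 1 (max_modulus f r)))) / ln r))"

definition normal_type :: "real \<Rightarrow> (complex \<Rightarrow> complex) \<Rightarrow> bool" where
  "normal_type \<rho> f \<longleftrightarrow>
     (let \<tau> = Limsup at_top (\<lambda>r. ereal (r powr (-\<rho>)) * log_ereal (max_modulus f r))
      in 0 < \<tau> \<and> \<tau> < \<infinity>)"

definition indicator_fun :: "real \<Rightarrow> (complex \<Rightarrow> complex) \<Rightarrow> real \<Rightarrow> ereal" where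
  "indicator_fun \<rho> f \<theta> =
     Limsup at_top (\<lambda>r. ereal (r powr (-\<rho>)) * log_ereal (cmod (f (of_real r * cis \<theta>))))"


section \<open>Distributions in the plane\<close>

text \<open>Real directional derivative; \<^const>\<open>frechet_derivative\<close> is over the reals, so for the
  directions \<open>1\<close> and \<open>\<i>\<close> these are the partial derivatives with respect to \<open>x\<close> and \<open>y\<close>.\<close>

definition dir_deriv :: "complex \<Rightarrow> (complex \<Rightarrow> complex) \<Rightarrow> complex \<Rightarrow> complex" where
  "dir_deriv v \<phi> z = frechet_derivative \<phi> (at z) v"

definition iter_deriv :: "complex list \<Rightarrow> (complex \<Rightarrow> complex) \<Rightarrow> complex \<Rightarrow> complex" where
  "iter_deriv vs \<phi> = foldr dir_deriv vs \<phi>"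

text \<open>\<open>C\<^sup>\<infinity>\<close> in the real sense: all iterated partial derivatives exist and are real differentiable.\<close>

definition smooth_plane :: "(complex \<Rightarrow> complex) \<Rightarrow> bool" where
  "smooth_plane \<phi> \<longleftrightarrow> (\<forall>vs. set vs \<subseteq> {1, \<i>} \<longrightarrow> iter_deriv vs \<phi> differentiable_on UNIV)"

definition fun_support :: "(complex \<Rightarrow> complex) \<Rightarrow> complex set" where
  "fun_support \<phi> = closure {z. \<phi> z \<noteq> 0}"

definition test_function :: "(complex \<Rightarrow> complex) \<Rightarrow> bool" where
  "test_function \<phi> \<longleftrightarrow> smooth_plane \<phi> \<and> compact (fun_support \<phi>)"

text \<open>A distribution is a linear functional on test functions that satisfies, on each compact
  set, a bound by finitely many sup-norms of derivatives.\<close>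

definition distribution :: "((complex \<Rightarrow> complex) \<Rightarrow> complex) \<Rightarrow> bool" where
  "distribution u \<longleftrightarrow>
     (\<forall>\<phi> \<psi>. test_function \<phi> \<longrightarrow> test_function \<psi> \<longrightarrow> u (\<lambda>z. \<phi> z + \<psi> z) = u \<phi> + u \<psi>) \<and>
     (\<forall>a \<phi>. test_function \<phi> \<longrightarrow> u (\<lambda>z. a * \<phi> z) = a * u \<phi>) \<and>
     (\<forall>K. compact K \<longrightarrow> (\<exists>C N. \<forall>\<phi>. test_function \<phi> \<longrightarrow> fun_support \<phi> \<subseteq> K \<longrightarrow>
        cmod (u \<phi>) \<le> C * (\<Sum>vs | set vs \<subseteq> {1, \<i>} \<and> length vs \<le> N. SUP z. cmod (iter_deriv vs \<phi> z))))"

text \<open>Convergence in \<open>D'\<close>, as \<open>t \<rightarrow> \<infinity>\<close>, of a family of functions \<open>g\<^sub>t\<close> regarded as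
  distributions \<open>\<phi> \<mapsto> \<integral> g\<^sub>t \<phi>\<close> with respect to area measure.  Integrability is demanded
  explicitly since the Bochner integral of a non-integrable function is 0.\<close>

definition tends_to_distribution ::
    "(real \<Rightarrow> complex \<Rightarrow> real) \<Rightarrow> ((complex \<Rightarrow> complex) \<Rightarrow> complex) \<Rightarrow> bool" where
  "tends_to_distribution g u \<longleftrightarrow> distribution u \<and>
     (\<forall>\<phi>. test_function \<phi> \<longrightarrow>
        (\<forall>\<^sub>F t in at_top. integrable lborel (\<lambda>z. of_real (g t z) * \<phi> z)) \<and>
        ((\<lambda>t. \<integral>z. of_real (g t z) * \<phi> z \<partial>lborel) \<longlongrightarrow> u \<phi>) at_top)"

text \<open>The value \<^term>\<open>ln (0::real) = 0\<close> is harmless below: the zeros of an entire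
  \<open>f \<noteq> 0\<close> form a null set.\<close>

definition completely_regular_growth :: "real \<Rightarrow> (complex \<Rightarrow> complex) \<Rightarrow> bool" where
  "completely_regular_growth \<rho> f \<longleftrightarrow>
     f holomorphic_on UNIV \<and> entire_order f = ereal \<rho> \<and> normal_type \<rho> f \<and>
     (\<exists>u. tends_to_distribution (\<lambda>t z. t powr (-\<rho>) * ln (cmod (f (of_real t * z)))) u)"

end

theory Submission
  imports Defs
begin

text \<open>
  Put \<open>\<sigma> = exp (\<rho> c - 1) / \<rho>\<close>, \<open>q = exp (2 \<pi> \<i> \<alpha>)\<close> and \<open>L\<^sub>t z = t\<^sup>-\<^sup>\<rho> ln |f (t z)|\<close>.  The size of the coefficients
  gives \<open>ln M(r) \<sim> \<sigma> r\<^sup>\<rho>\<close>.  Since \<open>c\<^sub>n\<^sub>+\<^sub>1 = h(n+1) c\<^sub>n\<close>, the function satisfies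
  \<open>f z - f 0 = q z (T f)(q\<^sup>2 z)\<close>, where \<open>T\<close> multiplies the \<open>n\<close>-th Taylor coefficient by \<open>h(n+1)\<close>.
  As \<open>h\<close> has minimal type, \<open>T\<close> is local: \<open>T f\<close> at \<open>z\<close> is bounded by a constant times the maximum of
  \<open>|f (z exp s)|\<close> over \<open>|s| = \<delta>\<close>, for any \<open>\<delta> > 0\<close>.  Hence if \<open>|f|\<close> is nearly maximal at \<open>z\<close>, it is nearly
  maximal at some point close to \<open>q\<^sup>2 z\<close>; as \<open>\<alpha>\<close> is irrational, iteration yields such points near
  every point of the circle.  By Jensen's inequality on small discs around these points, \<open>L\<^sub>t\<close>
  converges to \<open>\<sigma> |z|\<^sup>\<rho>\<close> locally in mean.  An indicator smaller than \<open>\<sigma>\<close> on some ray would make \<open>L\<^sub>t\<close>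
  too small on a full disc, by the two constants theorem in half discs.
\<close>

text \<open>The phases enter only through (n+1)^2 - n^2 = 2n + 1: the factor q^(2n) is a rotation of
  the argument by q^2. The functional equation bounds |f z| by values near q^2 z; read backwards, a
  large value at z forces a large value near q^2 z, but at an unknown point and with a loss. Hence
  points are transported instead of pointwise lower bounds, and compactness of the circle limits the
  number of rotations, so that all losses can be fixed in advance. Zeros of f exclude a pointwise
  lower bound for L_t; one good point per small disc is just what Jensen's inequality turns into a
  lower bound in mean. Convergence in mean says nothing about a single ray, which is a null set, so
  the indicator requires an argument of its own. The constant \<sigma> arises from maximising n (ln
  r + c) - n ln n / \<rho> over n: the maximum lies at n = exp (\<rho> c - 1) r^\<rho> and equals n
  / \<rho>.\<close>

section \<open>Rotation invariance of the area measure\<close>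

unbundle no fps_syntax

text \<open>Orthogonal invariance of Lebesgue measure is a statement about \<open>real^'n\<close>;
  this coordinate isometry carries it to \<open>complex\<close>, where a rotation is multiplication
  by a unimodular number.\<close>

definition vec2_of_complex :: "complex \<Rightarrow> real^2" where
  "vec2_of_complex z = vector [Re z, Im z]"

definition complex_of_vec2 :: "real^2 \<Rightarrow> complex" where
  "complex_of_vec2 v = Complex (v $ 1) (v $ 2)"

lemma complex_of_vec2_inverse [simp]: "complex_of_vec2 (vec2_of_complex z) = z"
  by (simp add: complex_of_vec2_def vec2_of_complex_def)

lemma linear_vec2_of_complex: "linear vec2_of_complex"
  by (rule linearI) (simp_all add: vec2_of_complex_def vec_eq_iff forall_2)

lemma linear_complex_of_vec2: "linear complex_of_vec2"
  by (rule linearI) (simp_all add: complex_of_vec2_def complex_eq_iff)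

lemma norm_complex_of_vec2: "norm (complex_of_vec2 v) = norm v"
  by (simp add: complex_of_vec2_def norm_vec_def L2_set_def sum_2 cmod_def)

lemma norm_vec2_of_complex: "norm (vec2_of_complex z) = norm z"
  by (metis complex_of_vec2_inverse norm_complex_of_vec2)

lemma borel_measurable_vec2 [measurable]:
  "vec2_of_complex \<in> borel_measurable borel" "complex_of_vec2 \<in> borel_measurable borel"
  by (auto intro!: borel_measurable_continuous_onI linear_continuous_on
      simp: linear_conv_bounded_linear[symmetric] linear_vec2_of_complex linear_complex_of_vec2)

lemma lborel_distr_vec2_of_complex: "distr lborel borel vec2_of_complex = lborel"
proof (rule lborel_eqI[symmetric])
  fix l u :: "real^2"
  assume le: "\<And>b. b \<in> Basis \<Longrightarrow> l \<bullet> b \<le> u \<bullet> b"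
  have le': "l $ i \<le> u $ i" for i
    using le[of "axis i 1"] by (simp add: axis_in_Basis_iff inner_axis)
  have *: "vec2_of_complex -` box l u = box (complex_of_vec2 l) (complex_of_vec2 u)"
    by (auto simp: vec2_of_complex_def complex_of_vec2_def mem_box_cart box_complex_eq
        in_box_complex_iff forall_2)
  have "emeasure (distr lborel borel vec2_of_complex) (box l u)
      = emeasure lborel (box (complex_of_vec2 l) (complex_of_vec2 u))"
    by (subst emeasure_distr) (auto simp: *)
  also have "\<dots> = ennreal (\<Prod>b\<in>Basis. (complex_of_vec2 u - complex_of_vec2 l) \<bullet> b)"
    by (rule emeasure_lborel_box) (auto simp: Basis_complex_def complex_of_vec2_def le')
  also have "(\<Prod>b\<in>Basis. (complex_of_vec2 u - complex_of_vec2 l) \<bullet> b) = (u $ 1 - l $ 1) * (u $ 2 - l $ 2)"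
    by (simp add: Basis_complex_def complex_of_vec2_def complex_eq_iff)
  also have "\<dots> = prod ((\<bullet>) (u - l)) Basis"
    by (simp add: Basis_vec_def UNIV_2 axis_eq_axis inner_axis)
  finally show "emeasure (distr lborel borel vec2_of_complex) (box l u) = ennreal (prod ((\<bullet>) (u - l)) Basis)" .
qed simp

lemma lborel_distr_complex_of_vec2: "distr lborel borel complex_of_vec2 = lborel"
proof -
  have "distr lborel borel complex_of_vec2
      = distr (distr lborel borel vec2_of_complex) borel complex_of_vec2"
    by (simp add: lborel_distr_vec2_of_complex)
  also have "\<dots> = distr lborel borel (\<lambda>z. z)"
    by (subst distr_distr) (auto simp: o_def)
  finally show ?thesis
    by (simp add: distr_id2)
qed

text \<open>\<open>lborel\<close> is determined by its values on boxes, and the preimage of a box is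
  its image under the orthogonal map \<open>inv f\<close>. The passage through
  \<open>lebesgue\<close> gives access to the invariance of \<open>measure lebesgue\<close>.\<close>

lemma lborel_distr_orthogonal_transformation:
  fixes f :: "real^'n::{finite,wellorder} \<Rightarrow> real^'n::{finite,wellorder}"
  assumes f: "orthogonal_transformation f"
  shows "distr lborel borel f = lborel"
proof (rule lborel_eqI[symmetric])
  fix l u :: "real^'n::{finite,wellorder}"
  assume le: "\<And>b. b \<in> Basis \<Longrightarrow> l \<bullet> b \<le> u \<bullet> b"
  have [measurable]: "f \<in> borel_measurable borel"
    using f by (auto intro!: borel_measurable_continuous_onI linear_continuous_on
      simp: linear_conv_bounded_linear[symmetric] orthogonal_transformation_linear)
  have bij: "bij f" and g: "orthogonal_transformation (inv f)"
    using f by (auto intro: orthogonal_transformation_bij orthogonal_transformation_inv)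
  have im: "f -` box l u = inv f ` box l u"
    using bij by (simp add: bij_vimage_eq_inv_image)
  have lm: "inv f ` box l u \<in> lmeasurable"
    using g by (intro measurable_linear_image) (auto simp: orthogonal_transformation_linear)
  have bo: "f -` box l u \<in> sets borel"
    using measurable_sets[of f borel borel "box l u"] by simp
  have "emeasure (distr lborel borel f) (box l u) = emeasure lborel (f -` box l u)"
    by (subst emeasure_distr) auto
  also have "\<dots> = emeasure lebesgue (inv f ` box l u)"
    using bo by (simp add: im)
  also have "\<dots> = ennreal (measure lebesgue (inv f ` box l u))"
    using lm by (simp add: emeasure_eq_measure2 fmeasurableD2)
  also have "measure lebesgue (inv f ` box l u) = measure lebesgue (box l u)"
    by (rule measure_orthogonal_image[OF g]) auto
  also have "ennreal (measure lebesgue (box l u)) = emeasure lborel (box l u)"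
    using emeasure_lborel_box_finite[of l u] by (simp add: emeasure_eq_ennreal_measure)
  also have "\<dots> = ennreal (prod ((\<bullet>) (u - l)) Basis)"
    using le by (rule emeasure_lborel_box)
  finally show "emeasure (distr lborel borel f) (box l u) = ennreal (prod ((\<bullet>) (u - l)) Basis)" .
qed simp

lemma lborel_distr_complex_rotation:
  fixes w :: complex
  assumes "cmod w = 1"
  shows "distr lborel borel (\<lambda>z. w * z) = lborel"
proof -
  define T where "T = (\<lambda>v. vec2_of_complex (w * complex_of_vec2 v))"
  have lin: "linear T"
    unfolding T_def using linear_vec2_of_complex linear_complex_of_vec2
    by (intro linearI)
       (simp_all add: linear_add linear_scale distrib_left)
  have T: "orthogonal_transformation T"
    unfolding orthogonal_transformation using lin assms
    by (auto simp: T_def norm_vec2_of_complex norm_mult norm_complex_of_vec2)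
  have [measurable]: "T \<in> borel_measurable borel"
    unfolding T_def by measurable
  have "distr lborel borel (\<lambda>z. w * z)
      = distr (distr (distr lborel borel vec2_of_complex) borel T) borel complex_of_vec2"
    by (subst distr_distr, simp, simp)+ (simp add: T_def o_def)
  then show ?thesis
    by (simp add: lborel_distr_vec2_of_complex lborel_distr_complex_of_vec2
        lborel_distr_orthogonal_transformation[OF T])
qed

section \<open>Jensen's inequality on discs\<close>

lemma norm_cis_diff_le: "cmod (cis a - cis b) \<le> \<bar>a - b\<bar>"
proof -
  have "cis a - cis b = cis b * (exp (\<i> * of_real (a - b)) - 1)"
    by (simp add: cis_conv_exp algebra_simps flip: exp_add)
  then have "cmod (cis a - cis b) = cmod (exp (\<i> * of_real (a - b)) - 1)"
    by (simp add: norm_mult)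
  also have "\<dots> \<le> \<bar>a - b\<bar>"
  proof -
    have "cmod (exp (\<i> * of_real (a - b)) - 1) = 2 * \<bar>sin ((a - b) / 2)\<bar>"
      using dist_exp_i_1[of "a - b"] by simp
    also have "\<dots> \<le> \<bar>a - b\<bar>"
      using abs_sin_x_le_abs_x[of "(a - b) / 2"] by simp
    finally show ?thesis .
  qed
  finally show ?thesis .
qed

text \<open>Serves to exchange an uncontrolled rotation for one by a root of unity, which merely
  permutes the roots. Rounding the angle down costs at most one arc of length 2 pi / n.\<close>

lemma root_of_unity_near:
  fixes v :: complex
  assumes "cmod v = 1" "n > 0"
  obtains \<zeta> where "\<zeta> ^ n = 1" "cmod (v - \<zeta>) \<le> 2 * pi / n"
proof -
  define x where "x = real n * Arg v / (2 * pi)"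
  define j where "j = \<lfloor>x\<rfloor>"
  let ?b = "2 * pi * of_int j / n"
  have v: "v = cis (Arg v)"
    using assms cis_Arg[of v] by (metis div_by_1 norm_zero of_real_1 sgn_eq zero_neq_one)
  have "cis ?b ^ n = cis (2 * pi * of_int j)"
    using assms by (simp add: Complex.DeMoivre)
  then have 1: "cis ?b ^ n = 1"
    by (metis Ints_of_int cis_multiple_2pi)
  have "cmod (v - cis ?b) \<le> \<bar>Arg v - ?b\<bar>"
    by (metis v norm_cis_diff_le)
  also have "Arg v - ?b = (x - of_int j) * (2 * pi / n)"
    using assms by (simp add: x_def field_simps)
  also have "\<bar>\<dots>\<bar> = \<bar>x - of_int j\<bar> * (2 * pi / n)"
    by (simp add: abs_mult)
  also have "\<dots> \<le> 1 * (2 * pi / n)"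
    by (intro mult_right_mono) (auto simp: j_def abs_le_iff, linarith)
  finally show ?thesis
    using that 1 by simp
qed

text \<open>The product over the roots is an entire function of w with value \<open>f z0 ^ n\<close>
  at w = 0, so the maximum principle applies on |w| = |z|. The maximising w is \<open>v * z\<close>;
  only the modulus of v is known.\<close>

lemma prod_roots_of_unity_ge:
  fixes f :: "complex \<Rightarrow> complex"
  assumes f: "f holomorphic_on UNIV" and n: "n > 0"
  obtains v where "cmod v = 1"
    "cmod (f z0) ^ n \<le> (\<Prod>\<zeta> | \<zeta> ^ n = 1. cmod (f (z0 + \<zeta> * v * z)))"
proof (cases "z = 0")
  case True
  then have "cmod (f z0) ^ n \<le> (\<Prod>\<zeta> | \<zeta> ^ n = 1. cmod (f (z0 + \<zeta> * 1 * z)))"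
    using n by (simp add: card_roots_unity_eq)
  then show ?thesis
    using that[of 1] by simp
next
  case False
  define G where "G = (\<lambda>w. \<Prod>\<zeta> | \<zeta> ^ n = 1. f (z0 + \<zeta> * w))"
  have hol: "(\<lambda>w. f (z0 + \<zeta> * w)) holomorphic_on UNIV" for \<zeta>
    using holomorphic_on_compose_gen[OF _ f, of "\<lambda>w. z0 + \<zeta> * w" UNIV]
    by (simp add: o_def holomorphic_intros)
  have G: "G holomorphic_on UNIV"
    unfolding G_def by (intro holomorphic_on_prod hol)
  then have cont: "continuous_on A G" for A
    by (meson continuous_on_subset holomorphic_on_imp_continuous_on top_greatest)
  have "compact (sphere (0::complex) (cmod z))" "sphere (0::complex) (cmod z) \<noteq> {}"
    by auto
  then obtain w where w: "w \<in> sphere 0 (cmod z)"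
      and max: "\<And>y. y \<in> sphere 0 (cmod z) \<Longrightarrow> cmod (G y) \<le> cmod (G w)"
    using continuous_attains_sup[of "sphere 0 (cmod z)" "\<lambda>w. cmod (G w)"]
    by (metis cont continuous_on_norm)
  \<comment> \<open>Cauchy's inequality for the derivative of order 0 is the maximum principle at
    the centre.\<close>
  have "cmod ((deriv ^^ 0) G 0) \<le> fact 0 * cmod (G w) / cmod z ^ 0"
    using False max
    by (intro Cauchy_inequality holomorphic_on_subset[OF G] cont) auto
  then have "cmod (f z0) ^ n \<le> cmod (G w)"
    using n by (simp add: G_def card_roots_unity_eq norm_power)
  also have "cmod (G w) = (\<Prod>\<zeta> | \<zeta> ^ n = 1. cmod (f (z0 + \<zeta> * (w / z) * z)))"
    using False by (simp add: G_def prod_norm mult.assoc)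
  finally show ?thesis
    using w False by (intro that[of "w / z"]) (auto simp: norm_divide)
qed

lemma ball_in_sets_borel [measurable]: "ball a r \<in> sets borel"
  by (intro borel_open open_ball)

lemma nn_integral_ball_rotate:
  fixes g :: "complex \<Rightarrow> ennreal"
  assumes [measurable]: "g \<in> borel_measurable borel" and w: "cmod w = 1"
  shows "(\<integral>\<^sup>+z\<in>ball 0 R. g (w * z) \<partial>lborel) = (\<integral>\<^sup>+z\<in>ball 0 R. g z \<partial>lborel)"
proof -
  have "(\<integral>\<^sup>+z\<in>ball 0 R. g z \<partial>lborel) = (\<integral>\<^sup>+z. g z * indicator (ball 0 R) z \<partial>distr lborel borel (\<lambda>z. w * z))"
    by (simp add: lborel_distr_complex_rotation[OF w])
  also have "\<dots> = (\<integral>\<^sup>+z. g (w * z) * indicator (ball 0 R) (w * z) \<partial>lborel)"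
    by (subst nn_integral_distr) auto
  also have "\<dots> = (\<integral>\<^sup>+z\<in>ball 0 R. g (w * z) \<partial>lborel)"
    using w by (intro nn_integral_cong) (auto simp: indicator_def norm_mult)
  finally show ?thesis ..
qed

lemma nn_integral_ball_shift:
  fixes g :: "complex \<Rightarrow> ennreal"
  assumes [measurable]: "g \<in> borel_measurable borel"
  shows "(\<integral>\<^sup>+z\<in>ball (a::complex) R. g z \<partial>lborel) = (\<integral>\<^sup>+z\<in>ball 0 R. g (a + z) \<partial>lborel)"
proof -
  have "(\<integral>\<^sup>+z\<in>ball a R. g z \<partial>lborel) = (\<integral>\<^sup>+z. g z * indicator (ball a R) z \<partial>distr lborel borel ((+) a))"
    by (simp add: lborel_distr_plus)
  also have "\<dots> = (\<integral>\<^sup>+z. g (a + z) * indicator (ball a R) (a + z) \<partial>lborel)"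
    by (subst nn_integral_distr) auto
  also have "\<dots> = (\<integral>\<^sup>+z\<in>ball 0 R. g (a + z) \<partial>lborel)"
    by (intro nn_integral_cong) (auto simp: indicator_def dist_norm)
  finally show ?thesis .
qed

lemma emeasure_ball_complex: "R \<ge> 0 \<Longrightarrow> emeasure lborel (ball (a::complex) R) = ennreal (pi * R\<^sup>2)"
  by (simp add: emeasure_ball unit_ball_vol_2)

text \<open>Means over the \<open>n\<close>-th roots of unity replace circular means, so that the rotation invariance of
  area suffices and no polar coordinates are needed.\<close>

lemma jensen_ball_truncated:
  fixes f :: "complex \<Rightarrow> complex"
  assumes f: "f holomorphic_on UNIV" and nz: "f z0 \<noteq> 0" and R: "R > 0" and \<eta>: "\<eta> > 0"
    and U: "\<And>z. z \<in> ball z0 R \<Longrightarrow> ln (max (cmod (f z)) \<eta>) \<le> U"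
  shows "(\<integral>\<^sup>+z\<in>ball z0 R. ennreal (U - ln (max (cmod (f z)) \<eta>)) \<partial>lborel)
           \<le> ennreal (pi * R\<^sup>2 * (U - ln (cmod (f z0))))"
proof -
  \<comment> \<open>Truncation at \<eta> keeps \<open>L\<close> continuous across the zeros of f;
    the comparison of nearby rotations below rests on its uniform continuity.\<close>
  define L where "L = (\<lambda>z. ln (max (cmod (f z)) \<eta>))"
  have "continuous_on UNIV f"
    using f by (rule holomorphic_on_imp_continuous_on)
  then have cont: "continuous_on A L" for A
    unfolding L_def using \<eta> by (intro continuous_intros) (auto intro: continuous_on_subset simp: max_def)
  have [measurable]: "L \<in> borel_measurable borel"
    using cont by (rule borel_measurable_continuous_onI)
  let ?A = "ln (cmod (f z0))"
  let ?I = "\<integral>\<^sup>+z\<in>ball z0 R. ennreal (U - L z) \<partial>lborel"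
  have AL: "?A \<le> L z0"
    unfolding L_def using nz by (intro ln_mono) auto
  have LU: "z \<in> ball z0 R \<Longrightarrow> L z \<le> U" for z
    using U by (simp add: L_def)
  have AU: "?A \<le> U"
    using AL LU[of z0] R by simp
  have main: "?I \<le> ennreal (pi * R\<^sup>2 * (U - ?A + e))" if e: "e > 0" for e
  proof -
    have "uniformly_continuous_on (cball z0 R) L"
      by (intro compact_uniformly_continuous cont) auto
    then obtain d where d: "d > 0" and
      unif: "\<And>x y. x \<in> cball z0 R \<Longrightarrow> y \<in> cball z0 R \<Longrightarrow> dist x y < d \<Longrightarrow> \<bar>L x - L y\<bar> < e"
      unfolding uniformly_continuous_on_def using e by (metis dist_real_def)
    \<comment> \<open>With this n, turning by an arc of length 2 pi / n moves each point of the disc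
      by less than the modulus of continuity \<open>d\<close>.\<close>
    obtain n :: nat where "n > 2 * pi * R / d"
      using reals_Archimedean2 by blast
    moreover have "2 * pi * R / d > 0"
      using R d by simp
    ultimately have n: "n > 0"
      by (intro Nat.gr0I) auto
    with \<open>n > 2 * pi * R / d\<close> have nd: "2 * pi / n * R < d"
      using d by (simp add: divide_less_eq mult_ac)
    define Z where "Z = {\<zeta>::complex. \<zeta> ^ n = 1}"
    have finZ: "finite Z" and cardZ: "card Z = n"
      using n by (auto simp: Z_def finite_roots_unity card_roots_unity_eq)
    have norm1: "cmod \<zeta> = 1" if "\<zeta> \<in> Z" for \<zeta>
      using that n power_eq_1_iff[of \<zeta> n] by (auto simp: Z_def)
    have sum_ge: "n * (?A - e) \<le> (\<Sum>\<zeta>\<in>Z. L (z0 + \<zeta> * z))" if z: "z \<in> ball 0 R" for z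
    proof -
      obtain v where v: "cmod v = 1" and
        prod: "cmod (f z0) ^ n \<le> (\<Prod>\<zeta>\<in>Z. cmod (f (z0 + \<zeta> * v * z)))"
        unfolding Z_def using prod_roots_of_unity_ge[OF f n] by metis
      obtain \<xi> where \<xi>: "\<xi> \<in> Z" "cmod (v - \<xi>) \<le> 2 * pi / n"
        unfolding Z_def using root_of_unity_near[OF v n] by auto
      have "\<xi> \<noteq> 0"
        using norm1[OF \<xi>(1)] by auto
      have "cmod (f z0) ^ n \<le> (\<Prod>\<zeta>\<in>Z. exp (L (z0 + \<zeta> * v * z)))"
        using prod by (rule order_trans) (use \<eta> in \<open>auto intro!: prod_mono simp: L_def\<close>)
      also have "\<dots> = exp (\<Sum>\<zeta>\<in>Z. L (z0 + \<zeta> * v * z))"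
        using finZ by (simp add: exp_sum)
      finally have "ln (cmod (f z0) ^ n) \<le> (\<Sum>\<zeta>\<in>Z. L (z0 + \<zeta> * v * z))"
        using nz by (metis ln_exp ln_mono zero_less_norm_iff zero_less_power)
      then have "n * ?A \<le> (\<Sum>\<zeta>\<in>Z. L (z0 + \<zeta> * v * z))"
        using nz by (simp add: ln_realpow)
      also have "\<dots> \<le> (\<Sum>\<zeta>\<in>Z. L (z0 + \<zeta> * \<xi> * z) + e)"
      proof (rule sum_mono)
        fix \<zeta> assume \<zeta>: "\<zeta> \<in> Z"
        have "dist (z0 + \<zeta> * v * z) (z0 + \<zeta> * \<xi> * z) = cmod (\<zeta> * (v - \<xi>) * z)"
          by (simp add: dist_norm algebra_simps)
        also have "\<dots> = cmod (v - \<xi>) * cmod z"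
          by (simp add: norm_mult norm1[OF \<zeta>])
        also have "\<dots> \<le> 2 * pi / n * R"
          using \<xi> z by (intro mult_mono) auto
        finally have "\<bar>L (z0 + \<zeta> * v * z) - L (z0 + \<zeta> * \<xi> * z)\<bar> < e"
          using nd z by (intro unif) (auto simp: dist_norm norm_mult norm1 \<zeta> v \<xi>)
        then show "L (z0 + \<zeta> * v * z) \<le> L (z0 + \<zeta> * \<xi> * z) + e"
          by linarith
      qed
      also have "\<dots> = (\<Sum>\<zeta>\<in>Z. L (z0 + \<zeta> * \<xi> * z)) + n * e"
        by (simp add: sum.distrib cardZ)
      \<comment> \<open>Multiplication by the root of unity \<xi> permutes \<open>Z\<close>, so the
        sum no longer depends on the unknown v.\<close>
      also have "(\<Sum>\<zeta>\<in>Z. L (z0 + \<zeta> * \<xi> * z)) = (\<Sum>\<zeta>\<in>Z. L (z0 + \<zeta> * z))"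
        using \<xi>(1) \<open>\<xi> \<noteq> 0\<close>
        by (intro sum.reindex_bij_witness[of _ "\<lambda>\<zeta>. \<zeta> / \<xi>" "\<lambda>\<zeta>. \<zeta> * \<xi>"])
           (auto simp: Z_def power_mult_distrib power_divide)
      finally show ?thesis
        by (simp add: algebra_simps)
    qed
    \<comment> \<open>By rotation invariance all n rotated integrals agree, so n times the integral
      is the integral of the sum controlled by \<open>sum_ge\<close>.\<close>
    have "of_nat n * ?I = (\<Sum>\<zeta>\<in>Z. \<integral>\<^sup>+z\<in>ball 0 R. ennreal (U - L (z0 + z)) \<partial>lborel)"
      by (subst nn_integral_ball_shift) (auto simp: cardZ)
    also have "\<dots> = (\<Sum>\<zeta>\<in>Z. \<integral>\<^sup>+z\<in>ball 0 R. ennreal (U - L (z0 + \<zeta> * z)) \<partial>lborel)"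
      by (intro sum.cong refl nn_integral_ball_rotate[symmetric]) (auto simp: norm1)
    also have "\<dots> = (\<integral>\<^sup>+z. (\<Sum>\<zeta>\<in>Z. ennreal (U - L (z0 + \<zeta> * z)) * indicator (ball 0 R) z) \<partial>lborel)"
      by (subst nn_integral_sum) auto
    also have "\<dots> \<le> (\<integral>\<^sup>+z. ennreal (n * (U - ?A + e)) * indicator (ball (0::complex) R) z \<partial>lborel)"
    proof (rule nn_integral_mono)
      fix z :: complex
      show "(\<Sum>\<zeta>\<in>Z. ennreal (U - L (z0 + \<zeta> * z)) * indicator (ball 0 R) z)
              \<le> ennreal (n * (U - ?A + e)) * indicator (ball 0 R) z"
      proof (cases "z \<in> ball 0 R")
        case True
        have nn: "U - L (z0 + \<zeta> * z) \<ge> 0" if "\<zeta> \<in> Z" for \<zeta>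
          using LU[of "z0 + \<zeta> * z"] True that by (auto simp: dist_norm norm_mult norm1)
        have "(\<Sum>\<zeta>\<in>Z. ennreal (U - L (z0 + \<zeta> * z))) = ennreal (\<Sum>\<zeta>\<in>Z. U - L (z0 + \<zeta> * z))"
          using nn by (simp add: sum_ennreal)
        also have "\<dots> \<le> ennreal (n * (U - ?A + e))"
          using sum_ge[OF True] by (intro ennreal_leI) (simp add: sum_subtractf cardZ algebra_simps)
        finally show ?thesis
          using True by simp
      qed simp
    qed
    also have "\<dots> = ennreal (n * (U - ?A + e)) * ennreal (pi * R\<^sup>2)"
      using R by (simp add: nn_integral_cmult_indicator emeasure_ball_complex)
    also have "\<dots> = of_nat n * ennreal (pi * R\<^sup>2 * (U - ?A + e))"
      using e AU by (simp add: ennreal_of_nat_eq_real_of_nat mult_ac flip: ennreal_mult)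
    finally have "of_nat n * ?I \<le> of_nat n * ennreal (pi * R\<^sup>2 * (U - ?A + e))" .
    then show ?thesis
      using n by (simp add: ennreal_mult_le_mult_iff)
  qed
  have "((\<lambda>e. ennreal (pi * R\<^sup>2 * (U - ?A + e))) \<longlongrightarrow> ennreal (pi * R\<^sup>2 * (U - ?A + 0))) (at_right 0)"
    by (intro tendsto_intros)
  moreover have "\<forall>\<^sub>F e in at_right 0. ?I \<le> ennreal (pi * R\<^sup>2 * (U - ?A + e))"
    using eventually_at_right_less[of 0] by eventually_elim (rule main)
  ultimately have "?I \<le> ennreal (pi * R\<^sup>2 * (U - ?A + 0))"
    by (intro tendsto_lowerbound) auto
  then show ?thesis
    by (simp add: L_def)
qed

text \<open>Fatou's lemma along the truncation levels exp (U - n), which decrease to 0.\<close>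

lemma jensen_ball:
  fixes f :: "complex \<Rightarrow> complex"
  assumes f: "f holomorphic_on UNIV" and nz: "f z0 \<noteq> 0" and R: "R > 0"
    and U: "\<And>z. z \<in> ball z0 R \<Longrightarrow> cmod (f z) \<le> exp U"
  shows "(\<integral>\<^sup>+z\<in>ball z0 R. ennreal (U - ln (cmod (f z))) \<partial>lborel)
           \<le> ennreal (pi * R\<^sup>2 * (U - ln (cmod (f z0))))"
proof -
  have [measurable]: "f \<in> borel_measurable borel"
    using f by (intro borel_measurable_continuous_onI holomorphic_on_imp_continuous_on)
  let ?g = "\<lambda>n z. ennreal (U - ln (max (cmod (f z)) (exp (U - real n)))) * indicator (ball z0 R) z"
  have "(\<integral>\<^sup>+z\<in>ball z0 R. ennreal (U - ln (cmod (f z))) \<partial>lborel)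
      \<le> (\<integral>\<^sup>+z. liminf (\<lambda>n. ?g n z) \<partial>lborel)"
  proof (intro nn_integral_mono Liminf_bounded)
    fix z
    show "\<forall>\<^sub>F n in sequentially. ennreal (U - ln (cmod (f z))) * indicator (ball z0 R) z \<le> ?g n z"
    proof (cases "f z = 0")
      case True
      \<comment> \<open>At a zero \<open>ln 0 = 0\<close>, so the integrand is
        \<open>ennreal U\<close>, while the truncated integrand equals n; it dominates once n >=
        U.\<close>
      have "\<forall>\<^sub>F n in sequentially. real n \<ge> U"
        by real_asymp
      then show ?thesis
        by eventually_elim (auto simp: True indicator_def max_def intro!: ennreal_leI)
    next
      case False
      have "\<forall>\<^sub>F n in sequentially. exp (U - real n) < cmod (f z)"
        using False by (intro order_tendstoD(2)[of _ 0]) (real_asymp, simp)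
      then show ?thesis
        by eventually_elim (auto simp: max_def)
    qed
  qed
  also have "\<dots> \<le> liminf (\<lambda>n. integral\<^sup>N lborel (?g n))"
    by (rule nn_integral_liminf) auto
  also have "\<dots> \<le> ennreal (pi * R\<^sup>2 * (U - ln (cmod (f z0))))"
  proof (intro Liminf_le always_eventually allI)
    fix n
    have "ln (max (cmod (f z)) (exp (U - real n))) \<le> U" if "z \<in> ball z0 R" for z
      using U[OF that] ln_mono[of "max (cmod (f z)) (exp (U - real n))" "exp U"]
      by (cases "f z = 0") (auto simp: max_def split: if_splits)
    then show "integral\<^sup>N lborel (?g n) \<le> ennreal (pi * R\<^sup>2 * (U - ln (cmod (f z0))))"
      by (intro jensen_ball_truncated[OF f nz R]) auto
  qed auto
  finally show ?thesis .
qed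

section \<open>From near-maxima everywhere to convergence in mean\<close>

lemma jensen_ball_scaled:
  fixes f :: "complex \<Rightarrow> complex"
  assumes f: "f holomorphic_on UNIV" and nz: "f (of_real t * z0) \<noteq> 0" and R: "R > 0" and t: "t > 0"
    and u: "\<And>z. z \<in> ball z0 R \<Longrightarrow> cmod (f (of_real t * z)) \<le> exp (t powr \<rho> * u)"
  shows "(\<integral>\<^sup>+z\<in>ball z0 R. ennreal (u - t powr (-\<rho>) * ln (cmod (f (of_real t * z)))) \<partial>lborel)
           \<le> ennreal (pi * R\<^sup>2 * (u - t powr (-\<rho>) * ln (cmod (f (of_real t * z0)))))"
proof -
  let ?U = "t powr \<rho> * u"
  have hol: "(\<lambda>z. f (of_real t * z)) holomorphic_on UNIV"
    using holomorphic_on_compose_gen[OF _ f, of "\<lambda>z. of_real t * z" UNIV]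
    by (simp add: o_def holomorphic_intros)
  have [measurable]: "(\<lambda>z. f (of_real t * z)) \<in> borel_measurable borel"
    using hol by (intro borel_measurable_continuous_onI holomorphic_on_imp_continuous_on)
  have inv: "t powr (-\<rho>) * t powr \<rho> = 1"
    using t by (simp flip: powr_add)
  have eq: "u - t powr (-\<rho>) * x = t powr (-\<rho>) * (?U - x)" for x
    by (simp add: right_diff_distrib inv flip: mult.assoc)
  have "(\<integral>\<^sup>+z\<in>ball z0 R. ennreal (u - t powr (-\<rho>) * ln (cmod (f (of_real t * z)))) \<partial>lborel)
      = ennreal (t powr (-\<rho>)) * (\<integral>\<^sup>+z\<in>ball z0 R. ennreal (?U - ln (cmod (f (of_real t * z)))) \<partial>lborel)"
    by (subst nn_integral_cmult[symmetric]) (auto simp: eq ennreal_mult' mult.assoc)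
  also have "\<dots> \<le> ennreal (t powr (-\<rho>)) * ennreal (pi * R\<^sup>2 * (?U - ln (cmod (f (of_real t * z0)))))"
    using jensen_ball[OF hol _ R, of z0 ?U] nz u by (intro mult_left_mono) auto
  also have "\<dots> = ennreal (pi * R\<^sup>2 * (u - t powr (-\<rho>) * ln (cmod (f (of_real t * z0)))))"
    by (simp add: eq mult_ac flip: ennreal_mult')
  finally show ?thesis .
qed

text \<open>A square piece of the lattice with mesh \<eta>. The point is that \<eta>^2 times the
  number of nodes stays bounded as \<eta> shrinks: each node will carry an error of order \<delta>
  \<eta>^2, and the total must be of order \<delta>.\<close>

lemma square_grid_cover:
  fixes R \<eta> :: real
  assumes R: "R > 0" and \<eta>: "\<eta> > 0"
  obtains P :: "complex set" where "finite P" "\<And>w. w \<in> P \<Longrightarrow> cmod w \<le> 2 * (R + \<eta>)"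
    "\<eta>\<^sup>2 * card P \<le> (2 * R + 3 * \<eta>)\<^sup>2"
    "\<And>z. z \<in> ball 0 R \<Longrightarrow> \<exists>w\<in>P. dist w z < 2 * \<eta>"
proof -
  define N where "N = \<lceil>R / \<eta>\<rceil>"
  define I where "I = {- N..N}"
  define g where "g = (\<lambda>(a::int, b::int). Complex (\<eta> * of_int a) (\<eta> * of_int b))"
  define P where "P = g ` (I \<times> I)"
  have N0: "N \<ge> 0"
    using divide_pos_pos[OF R \<eta>] unfolding N_def by linarith
  have N: "\<eta> * of_int N \<le> R + \<eta>"
  proof -
    have "of_int N \<le> R / \<eta> + 1"
      unfolding N_def by linarith
    then have "\<eta> * of_int N \<le> \<eta> * (R / \<eta> + 1)"
      using \<eta> by (intro mult_left_mono) auto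
    then show ?thesis
      using \<eta> by (simp add: distrib_left)
  qed
  have RN: "R \<le> \<eta> * of_int N"
    using \<eta> le_of_int_ceiling[of "R / \<eta>"] unfolding N_def
    by (simp only: pos_divide_le_eq mult.commute)
  show ?thesis
  proof
    show "finite P"
      by (simp add: P_def I_def)
    show "cmod w \<le> 2 * (R + \<eta>)" if w: "w \<in> P" for w
    proof -
      obtain a b where ab: "a \<in> I" "b \<in> I" "w = Complex (\<eta> * of_int a) (\<eta> * of_int b)"
        using w by (auto simp: P_def g_def)
      have bd: "\<bar>\<eta> * of_int x\<bar> \<le> R + \<eta>" if "x \<in> I" for x
      proof -
        have "real_of_int \<bar>x\<bar> \<le> of_int N"
          using that by (intro of_int_le_iff[THEN iffD2]) (auto simp: I_def)
        then have "\<eta> * \<bar>of_int x\<bar> \<le> \<eta> * of_int N"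
          using \<eta> by (intro mult_left_mono) auto
        then have "\<eta> * \<bar>of_int x\<bar> \<le> R + \<eta>"
          using N by linarith
        then show ?thesis
          using \<eta> by (simp add: abs_mult)
      qed
      have "cmod w \<le> \<bar>Re w\<bar> + \<bar>Im w\<bar>"
        by (rule cmod_le)
      then show ?thesis
        using bd[OF ab(1)] bd[OF ab(2)] by (simp add: ab)
    qed
    have "card P \<le> card (I \<times> I)"
      unfolding P_def by (rule card_image_le) (simp add: I_def)
    also have "real (card (I \<times> I)) = (2 * of_int N + 1)\<^sup>2"
      using N0 by (simp add: I_def card_cartesian_product power2_eq_square)
    finally have "\<eta>\<^sup>2 * card P \<le> \<eta>\<^sup>2 * (2 * of_int N + 1)\<^sup>2"
      by (intro mult_left_mono) auto
    also have "\<dots> = (2 * (\<eta> * of_int N) + \<eta>)\<^sup>2"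
      by (simp add: algebra_simps flip: power_mult_distrib)
    also have "\<dots> \<le> (2 * R + 3 * \<eta>)\<^sup>2"
      using N N0 \<eta> by (intro power_mono) auto
    finally show "\<eta>\<^sup>2 * card P \<le> (2 * R + 3 * \<eta>)\<^sup>2" .
    show "\<exists>w\<in>P. dist w z < 2 * \<eta>" if z: "z \<in> ball 0 R" for z
    proof
      let ?a = "\<lfloor>Re z / \<eta>\<rfloor>" and ?b = "\<lfloor>Im z / \<eta>\<rfloor>"
      have fl: "\<lfloor>x / \<eta>\<rfloor> \<in> I" "\<bar>\<eta> * of_int \<lfloor>x / \<eta>\<rfloor> - x\<bar> < \<eta>" if "\<bar>x\<bar> \<le> R" for x
      proof -
        have "\<bar>x / \<eta>\<bar> \<le> of_int N"
          using that RN \<eta> by (simp add: abs_divide divide_le_eq mult.commute)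
        then have "x / \<eta> \<le> of_int N" "- of_int N \<le> x / \<eta>"
          by linarith+
        then show "\<lfloor>x / \<eta>\<rfloor> \<in> I"
          by (simp add: I_def) linarith
        have "\<bar>of_int \<lfloor>x / \<eta>\<rfloor> - x / \<eta>\<bar> < 1"
          by linarith
        then have "\<eta> * \<bar>of_int \<lfloor>x / \<eta>\<rfloor> - x / \<eta>\<bar> < \<eta> * 1"
          using \<eta> by (intro mult_strict_left_mono)
        moreover have "\<eta> * of_int \<lfloor>x / \<eta>\<rfloor> - x = \<eta> * (of_int \<lfloor>x / \<eta>\<rfloor> - x / \<eta>)"
          using \<eta> by (simp add: right_diff_distrib)
        ultimately show "\<bar>\<eta> * of_int \<lfloor>x / \<eta>\<rfloor> - x\<bar> < \<eta>"
          using \<eta> by (simp add: abs_mult)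
      qed
      have re: "\<bar>Re z\<bar> \<le> R" "\<bar>Im z\<bar> \<le> R"
        using z abs_Re_le_cmod[of z] abs_Im_le_cmod[of z] by auto
      show "g (?a, ?b) \<in> P"
        using fl(1)[OF re(1)] fl(1)[OF re(2)] by (auto simp: P_def)
      have "dist (g (?a, ?b)) z \<le> \<bar>Re (g (?a, ?b) - z)\<bar> + \<bar>Im (g (?a, ?b) - z)\<bar>"
        unfolding dist_norm by (rule cmod_le)
      also have "\<dots> < 2 * \<eta>"
        using fl(2)[OF re(1)] fl(2)[OF re(2)] by (simp add: g_def)
      finally show "dist (g (?a, ?b)) z < 2 * \<eta>" .
    qed
  qed
qed

text \<open>Uniformity down to z = 0 is the issue: \<open>upper\<close> speaks only of large |t z|.
  On the remaining bounded set f is bounded by a constant, which the extra term e t^\<rho>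
  outgrows.\<close>

lemma upper_bound_scaled:
  fixes f :: "complex \<Rightarrow> complex"
  assumes f: "f holomorphic_on UNIV" and \<rho>: "\<rho> > 0" and \<sigma>: "\<sigma> \<ge> 0"
    and upper: "\<And>\<epsilon>. \<epsilon> > 0 \<Longrightarrow> \<forall>\<^sub>F r in at_top. \<forall>z. cmod z = r \<longrightarrow> cmod (f z) \<le> exp ((\<sigma> + \<epsilon>) * r powr \<rho>)"
    and R: "R > 0" and e: "e > 0"
  shows "\<forall>\<^sub>F t in at_top. \<forall>z\<in>cball 0 R.
           cmod (f (of_real t * z)) \<le> exp (t powr \<rho> * (\<sigma> * cmod z powr \<rho> + e))"
proof -
  define \<epsilon> where "\<epsilon> = e / (2 * R powr \<rho>)"
  have \<epsilon>: "\<epsilon> > 0"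
    using e R by (simp add: \<epsilon>_def)
  obtain r0 where r0: "\<And>z. cmod z \<ge> r0 \<Longrightarrow> cmod (f z) \<le> exp ((\<sigma> + \<epsilon>) * cmod z powr \<rho>)"
    using upper[OF \<epsilon>] unfolding eventually_at_top_linorder by blast
  have "bounded (f ` cball 0 r0)"
    by (intro compact_imp_bounded compact_continuous_image holomorphic_on_imp_continuous_on
        holomorphic_on_subset[OF f]) auto
  then obtain B where B: "B > 0" "\<And>z. cmod z \<le> r0 \<Longrightarrow> cmod (f z) \<le> B"
    by (auto simp: bounded_pos)
  have "filterlim (\<lambda>t. t powr \<rho> * (e / 2)) at_top at_top"
    using \<rho> e by real_asymp
  then have "\<forall>\<^sub>F t in at_top. ln B \<le> t powr \<rho> * (e / 2)"
    by (simp add: filterlim_at_top)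
  then show ?thesis
    using eventually_gt_at_top[of 0]
  proof eventually_elim
    case (elim t)
    show ?case
    proof
      fix z :: complex assume z: "z \<in> cball 0 R"
      have zt: "cmod (of_real t * z) powr \<rho> = t powr \<rho> * cmod z powr \<rho>"
        using elim by (simp add: norm_mult powr_mult)
      show "cmod (f (of_real t * z)) \<le> exp (t powr \<rho> * (\<sigma> * cmod z powr \<rho> + e))"
      proof (cases "cmod (of_real t * z) \<ge> r0")
        case True
        have "\<epsilon> * cmod z powr \<rho> \<le> \<epsilon> * R powr \<rho>"
          using \<epsilon> z \<rho> by (intro mult_left_mono powr_mono2) auto
        also have "\<dots> \<le> e"
          using e R by (simp add: \<epsilon>_def)
        finally have "t powr \<rho> * (\<epsilon> * cmod z powr \<rho>) \<le> t powr \<rho> * e"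
          by (intro mult_left_mono) auto
        then show ?thesis
          using r0[OF True] unfolding zt
          by (elim order_trans) (simp add: algebra_simps)
      next
        case False
        then have "cmod (f (of_real t * z)) \<le> exp (ln B)"
          using B by simp
        also have "\<dots> \<le> exp (t powr \<rho> * (\<sigma> * cmod z powr \<rho> + e))"
        proof -
          have "t powr \<rho> * (e / 2) \<le> t powr \<rho> * (\<sigma> * cmod z powr \<rho> + e)"
            using \<sigma> e by (intro mult_left_mono) auto
          with elim(1) show ?thesis
            by (metis exp_le_cancel_iff order_trans)
        qed
        finally show ?thesis .
      qed
    qed
  qed
qed

text \<open>\<open>upper\<close> bounds L_t from above at every point; Jensen's inequality turns a
  single point of \<open>dense\<close> into a bound for the mean defect on a disc around it.
  Finitely many such discs cover the ball.\<close>

lemma L1_convergence: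
  fixes f :: "complex \<Rightarrow> complex"
  assumes f: "f holomorphic_on UNIV" and \<rho>: "\<rho> > 0" and \<sigma>: "\<sigma> \<ge> 0"
    and upper: "\<And>\<epsilon>. \<epsilon> > 0 \<Longrightarrow> \<forall>\<^sub>F r in at_top. \<forall>z. cmod z = r \<longrightarrow> cmod (f z) \<le> exp ((\<sigma> + \<epsilon>) * r powr \<rho>)"
    and dense: "\<And>w \<eta> \<epsilon>. \<eta> > 0 \<Longrightarrow> \<epsilon> > 0 \<Longrightarrow> \<forall>\<^sub>F t in at_top. \<exists>z\<in>cball w \<eta>.
          exp (t powr \<rho> * (\<sigma> * cmod z powr \<rho> - \<epsilon>)) \<le> cmod (f (of_real t * z))"
    and R: "R > 0" and e: "e > 0"
  shows "\<forall>\<^sub>F t in at_top. (\<integral>\<^sup>+z\<in>ball 0 R. ennreal \<bar>t powr (-\<rho>) * ln (cmod (f (of_real t * z)))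
            - \<sigma> * cmod z powr \<rho>\<bar> \<partial>lborel) \<le> ennreal e"
proof -
  define S where "S = (\<lambda>z::complex. \<sigma> * cmod z powr \<rho>)"
  have S0: "S z \<ge> 0" for z
    using \<sigma> by (simp add: S_def)
  \<comment> \<open>Each disc contributes 54 \<pi> \<delta> \<eta>^2, and \<eta>^2 times the number
    of discs is at most (2 R + 3)^2; the total is then e.\<close>
  define \<delta> where "\<delta> = e / (54 * pi * (2 * R + 3)\<^sup>2)"
  have \<delta>: "\<delta> > 0"
    using e R by (simp add: \<delta>_def)
  have contS: "continuous_on A S" for A
    unfolding S_def using \<rho> by (intro continuous_intros continuous_on_powr') auto
  then have [measurable]: "S \<in> borel_measurable borel"
    by (intro borel_measurable_continuous_onI)
  \<comment> \<open>Nodes satisfy |w| <= 2 R + 2; the good point is at most 1 away from its node,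
    and the disc around it has radius at most 3.\<close>
  let ?R = "2 * R + 6"
  have "uniformly_continuous_on (cball 0 ?R) S"
    by (intro compact_uniformly_continuous contS) auto
  then obtain d where d: "d > 0" and
    unif: "\<And>x y. x \<in> cball 0 ?R \<Longrightarrow> y \<in> cball 0 ?R \<Longrightarrow> dist x y < d \<Longrightarrow> \<bar>S x - S y\<bar> < \<delta>"
    unfolding uniformly_continuous_on_def using \<delta> by (metis dist_real_def)
  define \<eta> where "\<eta> = min 1 (d / 4)"
  have \<eta>: "\<eta> > 0" "\<eta> \<le> 1" "3 * \<eta> < d"
    using d by (auto simp: \<eta>_def min_def)
  obtain P :: "complex set" where P: "finite P" "\<And>w. w \<in> P \<Longrightarrow> cmod w \<le> 2 * (R + \<eta>)"
    "\<eta>\<^sup>2 * card P \<le> (2 * R + 3 * \<eta>)\<^sup>2"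
    "\<And>z. z \<in> ball 0 R \<Longrightarrow> \<exists>w\<in>P. dist w z < 2 * \<eta>"
    using square_grid_cover[OF R \<eta>(1)] by metis
  have "\<forall>\<^sub>F t in at_top. \<forall>w\<in>P. \<exists>z\<in>cball w \<eta>. exp (t powr \<rho> * (S z - \<delta>)) \<le> cmod (f (of_real t * z))"
    unfolding S_def using dense[OF \<eta>(1) \<delta>] P(1) by (intro eventually_ball_finite) auto
  moreover have "\<forall>\<^sub>F t in at_top. \<forall>z\<in>cball 0 ?R. cmod (f (of_real t * z)) \<le> exp (t powr \<rho> * (S z + \<delta>))"
    unfolding S_def using R \<delta> by (intro upper_bound_scaled f \<rho> \<sigma> upper) auto
  ultimately show ?thesis
    using eventually_gt_at_top[of 0]
  proof eventually_elim
    case (elim t)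
    define L where "L = (\<lambda>z. t powr (-\<rho>) * ln (cmod (f (of_real t * z))))"
    have [measurable]: "f \<in> borel_measurable borel"
      using f by (intro borel_measurable_continuous_onI holomorphic_on_imp_continuous_on)
    have [measurable]: "L \<in> borel_measurable borel"
      unfolding L_def by measurable
    have inv: "t powr (-\<rho>) * t powr \<rho> = 1"
      using elim by (simp flip: powr_add)
    from elim(1) obtain zz where zz: "\<And>w. w \<in> P \<Longrightarrow> zz w \<in> cball w \<eta>"
      "\<And>w. w \<in> P \<Longrightarrow> exp (t powr \<rho> * (S (zz w) - \<delta>)) \<le> cmod (f (of_real t * zz w))"
      by metis
    have L_upper: "L z \<le> S z + \<delta>" if "z \<in> cball 0 ?R" for z
    proof (cases "f (of_real t * z) = 0")
      \<comment> \<open>At a zero the convention \<open>ln 0 = 0\<close> gives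
        \<open>L z = 0\<close>, which respects the bound because \<open>S\<close> is
        nonnegative.\<close>
      case True
      then show ?thesis
        using S0[of z] \<delta> by (simp add: L_def)
    next
      case False
      then have "ln (cmod (f (of_real t * z))) \<le> ln (exp (t powr \<rho> * (S z + \<delta>)))"
        using elim(2) that by (intro ln_mono) auto
      then have "L z \<le> t powr (-\<rho>) * (t powr \<rho> * (S z + \<delta>))"
        unfolding L_def by (intro mult_left_mono) auto
      then show ?thesis
        by (simp add: inv flip: mult.assoc)
    qed
    have local: "(\<integral>\<^sup>+z\<in>ball (zz w) (3 * \<eta>). ennreal \<bar>L z - S z\<bar> \<partial>lborel) \<le> ennreal (54 * pi * \<delta> * \<eta>\<^sup>2)"
      if w: "w \<in> P" for w
    proof -
      \<comment> \<open>One \<delta> for the excess of L over S, one for the oscillation of S on the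
        disc. Together with the loss \<delta> at the good point, the defect there is at most 3
        \<delta>. The radius is 3 \<eta> since a node is within \<eta> of its good point and within
        2 \<eta> of the points it has to cover.\<close>
      let ?B = "ball (zz w) (3 * \<eta>)" and ?u = "S (zz w) + 2 * \<delta>"
      have sub: "?B \<subseteq> cball 0 ?R"
      proof
        fix z assume "z \<in> ?B"
        then have "cmod z < cmod w + \<eta> + 3 * \<eta>"
          using zz(1)[OF w] norm_triangle_ineq3[of z "zz w"] norm_triangle_ineq3[of "zz w" w]
          by (auto simp: dist_norm norm_minus_commute)
        then show "z \<in> cball 0 ?R"
          using P(2)[OF w] \<eta> by simp
      qed
      then have zzR: "zz w \<in> cball 0 ?R"
        using \<eta> by (meson centre_in_ball mult_pos_pos subsetD zero_less_numeral)
      have near: "\<bar>S z - S (zz w)\<bar> < \<delta>" if "z \<in> ?B" for z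
        using that sub zzR \<eta> by (intro unif) (auto simp: dist_commute)
      have nz: "f (of_real t * zz w) \<noteq> 0"
        using zz(2)[OF w] by (metis exp_gt_zero norm_zero not_less)
      have "ln (exp (t powr \<rho> * (S (zz w) - \<delta>))) \<le> ln (cmod (f (of_real t * zz w)))"
        using zz(2)[OF w] by (intro ln_mono) auto
      then have "t powr (-\<rho>) * (t powr \<rho> * (S (zz w) - \<delta>)) \<le> L (zz w)"
        unfolding L_def by (intro mult_left_mono) auto
      then have L_lower: "S (zz w) - \<delta> \<le> L (zz w)"
        by (simp add: inv flip: mult.assoc)
      have "cmod (f (of_real t * z)) \<le> exp (t powr \<rho> * ?u)" if "z \<in> ?B" for z
      proof -
        have "cmod (f (of_real t * z)) \<le> exp (t powr \<rho> * (S z + \<delta>))"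
          using elim(2) sub that by auto
        also have "\<dots> \<le> exp (t powr \<rho> * ?u)"
          using near[OF that] by (auto intro!: mult_left_mono)
        finally show ?thesis .
      qed
      then have "(\<integral>\<^sup>+z\<in>?B. ennreal (?u - L z) \<partial>lborel) \<le> ennreal (pi * (3 * \<eta>)\<^sup>2 * (?u - L (zz w)))"
        unfolding L_def using \<eta> elim by (intro jensen_ball_scaled f nz) auto
      also have "\<dots> \<le> ennreal (pi * (3 * \<eta>)\<^sup>2 * (3 * \<delta>))"
        using L_lower by (intro ennreal_leI mult_left_mono) auto
      finally have 1: "(\<integral>\<^sup>+z\<in>?B. ennreal (?u - L z) \<partial>lborel) \<le> ennreal (27 * pi * \<delta> * \<eta>\<^sup>2)"
        by (simp add: power_mult_distrib mult_ac)
      have 2: "(\<integral>\<^sup>+z\<in>?B. ennreal (3 * \<delta>) \<partial>lborel) = ennreal (27 * pi * \<delta> * \<eta>\<^sup>2)"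
        using \<eta> \<delta> by (simp add: nn_integral_cmult_indicator emeasure_ball_complex power_mult_distrib
            mult_ac flip: ennreal_mult')
      have "(\<integral>\<^sup>+z\<in>?B. ennreal \<bar>L z - S z\<bar> \<partial>lborel)
          \<le> (\<integral>\<^sup>+z. (ennreal (?u - L z) * indicator ?B z + ennreal (3 * \<delta>) * indicator ?B z) \<partial>lborel)"
      proof (intro nn_integral_mono)
        fix z
        show "ennreal \<bar>L z - S z\<bar> * indicator ?B z
            \<le> ennreal (?u - L z) * indicator ?B z + ennreal (3 * \<delta>) * indicator ?B z"
        proof (cases "z \<in> ?B")
          case True
          have "L z \<le> S z + \<delta>" "\<bar>S z - S (zz w)\<bar> < \<delta>"
            using L_upper sub True near by auto
          \<comment> \<open>Compare both L and S with the constant \<open>?u\<close>, which exceeds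
            S by less than 3 \<delta>.\<close>
          then have "\<bar>L z - S z\<bar> \<le> (?u - L z) + 3 * \<delta>" "?u - L z \<ge> 0"
            by linarith+
          then show ?thesis
            using True \<delta> by (simp add: ennreal_leI flip: ennreal_plus)
        qed simp
      qed
      also have "\<dots> = (\<integral>\<^sup>+z\<in>?B. ennreal (?u - L z) \<partial>lborel) + (\<integral>\<^sup>+z\<in>?B. ennreal (3 * \<delta>) \<partial>lborel)"
        by (rule nn_integral_add) auto
      also have "\<dots> \<le> ennreal (27 * pi * \<delta> * \<eta>\<^sup>2) + ennreal (27 * pi * \<delta> * \<eta>\<^sup>2)"
        using 1 2 by (intro add_mono) auto
      also have "\<dots> = ennreal (54 * pi * \<delta> * \<eta>\<^sup>2)"
        using \<delta> by (simp flip: ennreal_plus)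
      finally show ?thesis .
    qed
    have "(\<integral>\<^sup>+z\<in>ball 0 R. ennreal \<bar>L z - S z\<bar> \<partial>lborel)
        \<le> (\<integral>\<^sup>+z. (\<Sum>w\<in>P. ennreal \<bar>L z - S z\<bar> * indicator (ball (zz w) (3 * \<eta>)) z) \<partial>lborel)"
    proof (intro nn_integral_mono)
      fix z :: complex
      show "ennreal \<bar>L z - S z\<bar> * indicator (ball 0 R) z
          \<le> (\<Sum>w\<in>P. ennreal \<bar>L z - S z\<bar> * indicator (ball (zz w) (3 * \<eta>)) z)"
      proof (cases "z \<in> ball 0 R")
        case True
        then obtain w where w: "w \<in> P" "dist w z < 2 * \<eta>"
          using P(4) by blast
        then have "dist (zz w) z < 3 * \<eta>"
          using zz(1)[OF w(1)] dist_triangle[of "zz w" z w] by (auto simp: dist_commute)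
        then have "ennreal \<bar>L z - S z\<bar> * indicator (ball 0 R) z
            = ennreal \<bar>L z - S z\<bar> * indicator (ball (zz w) (3 * \<eta>)) z"
          using True by simp
        also have "\<dots> \<le> (\<Sum>w\<in>P. ennreal \<bar>L z - S z\<bar> * indicator (ball (zz w) (3 * \<eta>)) z)"
          using w P(1) by (intro member_le_sum) auto
        finally show ?thesis .
      qed simp
    qed
    also have "\<dots> = (\<Sum>w\<in>P. \<integral>\<^sup>+z\<in>ball (zz w) (3 * \<eta>). ennreal \<bar>L z - S z\<bar> \<partial>lborel)"
      by (subst nn_integral_sum) auto
    also have "\<dots> \<le> (\<Sum>w\<in>P. ennreal (54 * pi * \<delta> * \<eta>\<^sup>2))"
      by (intro sum_mono local)
    also have "\<dots> = ennreal (54 * pi * \<delta> * (\<eta>\<^sup>2 * card P))"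
      using \<delta> by (simp add: ennreal_of_nat_eq_real_of_nat mult_ac flip: ennreal_mult)
    also have "\<dots> \<le> ennreal (54 * pi * \<delta> * (2 * R + 3)\<^sup>2)"
    proof -
      have "(2 * R + 3 * \<eta>)\<^sup>2 \<le> (2 * R + 3)\<^sup>2"
        using \<eta> R by (intro power_mono) auto
      then show ?thesis
        using P(3) \<delta> by (intro ennreal_leI mult_left_mono) auto
    qed
    also have "54 * pi * \<delta> * (2 * R + 3)\<^sup>2 = e"
      using R by (simp add: \<delta>_def)
    finally show ?case
      by (simp add: L_def S_def)
  qed
qed

section \<open>Convergence as distributions\<close>

lemma test_function_imp_continuous:
  assumes "test_function \<phi>"
  shows "continuous_on UNIV \<phi>"
proof -
  have "iter_deriv [] \<phi> differentiable_on UNIV"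
    using assms unfolding test_function_def smooth_plane_def by (metis empty_iff empty_set subsetI)
  then show ?thesis
    by (intro differentiable_imp_continuous_on) (simp add: iter_deriv_def)
qed

lemma in_fun_support: "\<phi> z \<noteq> 0 \<Longrightarrow> z \<in> fun_support \<phi>"
  unfolding fun_support_def using closure_subset[of "{z. \<phi> z \<noteq> 0}"] by auto

lemma test_function_bounded:
  assumes \<phi>: "test_function \<phi>"
  obtains B where "B > 0" "\<And>z. cmod (\<phi> z) \<le> B"
proof -
  have "compact (\<phi> ` fun_support \<phi>)"
    using \<phi> by (intro compact_continuous_image continuous_on_subset[OF test_function_imp_continuous])
      (auto simp: test_function_def)
  then have "bounded (\<phi> ` fun_support \<phi>)"
    by (rule compact_imp_bounded)
  then obtain B where B: "B > 0" "\<And>z. z \<in> fun_support \<phi> \<Longrightarrow> cmod (\<phi> z) \<le> B"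
    by (auto simp: bounded_pos)
  have "cmod (\<phi> z) \<le> B" for z
  proof (cases "\<phi> z = 0")
    case False
    then have "z \<in> fun_support \<phi>"
      by (rule in_fun_support)
    then show ?thesis
      by (rule B)
  qed (use B in simp)
  then show ?thesis
    using that B(1) by blast
qed

lemma test_function_support_ball:
  assumes \<phi>: "test_function \<phi>"
  obtains R where "R > 0" "\<And>z. z \<notin> ball 0 R \<Longrightarrow> \<phi> z = 0"
proof -
  have "bounded (fun_support \<phi>)"
    using \<phi> by (auto simp: test_function_def compact_imp_bounded)
  then obtain R where R: "R > 0" "fun_support \<phi> \<subseteq> ball 0 R"
    using bounded_subset_ballD[of "fun_support \<phi>" 0] by auto
  have "\<phi> z = 0" if "z \<notin> ball 0 R" for z
    using that R(2) in_fun_support[of \<phi> z] by (meson subsetD)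
  then show ?thesis
    using R(1) that by metis
qed

lemma integral_times_bounded_le:
  fixes g :: "complex \<Rightarrow> real" and \<phi> :: "complex \<Rightarrow> complex"
  assumes [measurable]: "g \<in> borel_measurable borel" "\<phi> \<in> borel_measurable borel"
    and g: "(\<integral>\<^sup>+z\<in>ball 0 R. ennreal \<bar>g z\<bar> \<partial>lborel) \<le> ennreal e" and e: "e \<ge> 0"
    and B: "\<And>z. cmod (\<phi> z) \<le> B" and \<phi>0: "\<And>z. z \<notin> ball 0 R \<Longrightarrow> \<phi> z = 0"
  shows "integrable lborel (\<lambda>z. of_real (g z) * \<phi> z)"
    and "cmod (\<integral>z. of_real (g z) * \<phi> z \<partial>lborel) \<le> B * e"
proof -
  have B0: "B \<ge> 0"
    using order_trans[OF norm_ge_zero B] .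
  have "(\<integral>\<^sup>+z. ennreal (norm (of_real (g z) * \<phi> z)) \<partial>lborel)
      \<le> (\<integral>\<^sup>+z. ennreal B * (ennreal \<bar>g z\<bar> * indicator (ball 0 R) z) \<partial>lborel)"
  proof (intro nn_integral_mono)
    fix z
    show "ennreal (norm (of_real (g z) * \<phi> z)) \<le> ennreal B * (ennreal \<bar>g z\<bar> * indicator (ball 0 R) z)"
    proof (cases "z \<in> ball 0 R")
      case True
      have "norm (of_real (g z) * \<phi> z) \<le> B * \<bar>g z\<bar>"
        using mult_right_mono[OF B[of z], of "\<bar>g z\<bar>"] by (simp add: norm_mult mult.commute)
      then show ?thesis
        using True B0 by (simp add: ennreal_leI flip: ennreal_mult')
    qed (simp add: \<phi>0)
  qed
  also have "\<dots> = ennreal B * (\<integral>\<^sup>+z\<in>ball 0 R. ennreal \<bar>g z\<bar> \<partial>lborel)"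
    by (rule nn_integral_cmult) measurable
  also have "\<dots> \<le> ennreal B * ennreal e"
    using g by (intro mult_left_mono) auto
  also have "\<dots> = ennreal (B * e)"
    using B0 e by (simp add: ennreal_mult)
  finally have nn: "(\<integral>\<^sup>+z. ennreal (norm (of_real (g z) * \<phi> z)) \<partial>lborel) \<le> ennreal (B * e)" .
  then show int: "integrable lborel (\<lambda>z. of_real (g z) * \<phi> z)"
    by (intro integrableI_bounded) (auto intro: le_less_trans)
  have "cmod (\<integral>z. of_real (g z) * \<phi> z \<partial>lborel) \<le> (\<integral>z. norm (of_real (g z) * \<phi> z) \<partial>lborel)"
    by (rule integral_norm_bound)
  also have "\<dots> = enn2real (\<integral>\<^sup>+z. ennreal (norm (of_real (g z) * \<phi> z)) \<partial>lborel)"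
    by (rule integral_eq_nn_integral) auto
  also have "\<dots> \<le> enn2real (ennreal (B * e))"
    using nn by (intro enn2real_mono) auto
  also have "\<dots> = B * e"
    using B0 e by simp
  finally show "cmod (\<integral>z. of_real (g z) * \<phi> z \<partial>lborel) \<le> B * e" .
qed

text \<open>A continuous density is of order 0 on every compact set: the sup norm of the test
  function suffices, with the integral of |S| over a surrounding ball as constant.\<close>

lemma distribution_of_continuous:
  fixes S :: "complex \<Rightarrow> real"
  assumes S: "continuous_on UNIV S"
  shows "distribution (\<lambda>\<phi>. \<integral>z. of_real (S z) * \<phi> z \<partial>lborel)"
    and "test_function \<phi> \<Longrightarrow> integrable lborel (\<lambda>z. of_real (S z) * \<phi> z)"
proof -
  have Sm [measurable]: "S \<in> borel_measurable borel"
    using S by (rule borel_measurable_continuous_onI)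
  have bd: "\<exists>e\<ge>0. (\<integral>\<^sup>+z\<in>ball 0 R. ennreal \<bar>S z\<bar> \<partial>lborel) \<le> ennreal e" if R: "R > 0" for R
  proof -
    have "bounded (S ` cball 0 R)"
      by (intro compact_imp_bounded compact_continuous_image continuous_on_subset[OF S]) auto
    then obtain M where M: "M > 0" "\<And>z. z \<in> cball 0 R \<Longrightarrow> \<bar>S z\<bar> \<le> M"
      by (auto simp: bounded_pos)
    have "(\<integral>\<^sup>+z\<in>ball 0 R. ennreal \<bar>S z\<bar> \<partial>lborel) \<le> (\<integral>\<^sup>+z\<in>ball (0::complex) R. ennreal M \<partial>lborel)"
      using M by (intro nn_integral_mono) (auto simp: indicator_def intro!: ennreal_leI)
    also have "\<dots> = ennreal (M * (pi * R\<^sup>2))"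
      using R M by (simp add: nn_integral_cmult_indicator emeasure_ball_complex ennreal_mult)
    finally show ?thesis
      using M by (intro exI[of _ "M * (pi * R\<^sup>2)"]) auto
  qed
  have meas: "\<phi> \<in> borel_measurable borel" if "test_function \<phi>" for \<phi>
    using test_function_imp_continuous[OF that] by (rule borel_measurable_continuous_onI)
  show int: "integrable lborel (\<lambda>z. of_real (S z) * \<phi> z)" if \<phi>: "test_function \<phi>" for \<phi>
  proof -
    obtain B where B: "\<And>z. cmod (\<phi> z) \<le> B"
      using test_function_bounded[OF \<phi>] by metis
    obtain R where R: "R > 0" "\<And>z. z \<notin> ball 0 R \<Longrightarrow> \<phi> z = 0"
      using test_function_support_ball[OF \<phi>] by metis
    obtain e where "e \<ge> 0" "(\<integral>\<^sup>+z\<in>ball 0 R. ennreal \<bar>S z\<bar> \<partial>lborel) \<le> ennreal e"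
      using bd[OF R(1)] by blast
    then show ?thesis
      using B R by (intro integral_times_bounded_le(1)[OF Sm meas[OF \<phi>]]) auto
  qed
  show "distribution (\<lambda>\<phi>. \<integral>z. of_real (S z) * \<phi> z \<partial>lborel)"
    unfolding distribution_def
  proof (intro conjI allI impI)
    fix \<phi> \<psi> assume \<phi>: "test_function \<phi>" and \<psi>: "test_function \<psi>"
    show "(\<integral>z. of_real (S z) * (\<phi> z + \<psi> z) \<partial>lborel)
        = (\<integral>z. of_real (S z) * \<phi> z \<partial>lborel) + (\<integral>z. of_real (S z) * \<psi> z \<partial>lborel)"
      using int[OF \<phi>] int[OF \<psi>] by (simp add: distrib_left)
  next
    fix a :: complex and \<phi> :: "complex \<Rightarrow> complex"
    have "(\<integral>z. of_real (S z) * (a * \<phi> z) \<partial>lborel) = (\<integral>z. a * (of_real (S z) * \<phi> z) \<partial>lborel)"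
      by (simp add: mult_ac)
    also have "\<dots> = a * (\<integral>z. of_real (S z) * \<phi> z \<partial>lborel)"
      by (rule integral_mult_right_zero)
    finally show "(\<integral>z. of_real (S z) * (a * \<phi> z) \<partial>lborel) = a * (\<integral>z. of_real (S z) * \<phi> z \<partial>lborel)" .
  next
    fix K :: "complex set" assume K: "compact K"
    obtain R where R: "R > 0" "\<And>z. z \<notin> ball 0 R \<Longrightarrow> z \<notin> K"
      using bounded_subset_ballD[OF compact_imp_bounded[OF K], of 0] by (meson subsetD)
    obtain e where e: "e \<ge> 0" "(\<integral>\<^sup>+z\<in>ball 0 R. ennreal \<bar>S z\<bar> \<partial>lborel) \<le> ennreal e"
      using bd[OF R(1)] by blast
    have "cmod (\<integral>z. of_real (S z) * \<phi> z \<partial>lborel)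
        \<le> e * (\<Sum>vs | set vs \<subseteq> {1, \<i>} \<and> length vs \<le> 0. SUP z. cmod (iter_deriv vs \<phi> z))"
      if \<phi>: "test_function \<phi>" and supp: "fun_support \<phi> \<subseteq> K" for \<phi>
    proof -
      obtain B where B: "\<And>z. cmod (\<phi> z) \<le> B"
        using test_function_bounded[OF \<phi>] by metis
      have \<phi>0: "\<phi> z = 0" if "z \<notin> ball 0 R" for z
        using R(2)[OF that] supp in_fun_support[of \<phi> z] by auto
      \<comment> \<open>The sup norm itself must serve as the bound; B only shows that the real
        supremum is taken over a bounded set.\<close>
      have sup: "cmod (\<phi> z) \<le> (SUP z. cmod (\<phi> z))" for z
        using B by (intro cSUP_upper bdd_aboveI2) auto
      have "{vs. set vs \<subseteq> {1, \<i>} \<and> length vs \<le> 0} = {[]}"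
        by auto
      then show ?thesis
        using integral_times_bounded_le(2)[OF Sm meas[OF \<phi>] e(2,1) sup \<phi>0]
        by (simp add: iter_deriv_def mult.commute)
    qed
    then show "\<exists>C N. \<forall>\<phi>. test_function \<phi> \<longrightarrow> fun_support \<phi> \<subseteq> K \<longrightarrow>
        cmod (\<integral>z. of_real (S z) * \<phi> z \<partial>lborel)
        \<le> C * (\<Sum>vs | set vs \<subseteq> {1, \<i>} \<and> length vs \<le> N. SUP z. cmod (iter_deriv vs \<phi> z))"
      by blast
  qed
qed

text \<open>Test functions are bounded with compact support, so convergence in mean on balls can be
  tested against them. Integrability is inherited from that of the difference and of the continuous
  limit.\<close>

lemma tends_to_distribution_of_L1:
  fixes g :: "real \<Rightarrow> complex \<Rightarrow> real" and S :: "complex \<Rightarrow> real"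
  assumes S: "continuous_on UNIV S" and g: "\<And>t. g t \<in> borel_measurable borel"
    and conv: "\<And>R e. R > 0 \<Longrightarrow> e > 0 \<Longrightarrow>
      \<forall>\<^sub>F t in at_top. (\<integral>\<^sup>+z\<in>ball 0 R. ennreal \<bar>g t z - S z\<bar> \<partial>lborel) \<le> ennreal e"
  shows "tends_to_distribution g (\<lambda>\<phi>. \<integral>z. of_real (S z) * \<phi> z \<partial>lborel)"
  unfolding tends_to_distribution_def
proof (intro conjI allI impI distribution_of_continuous S)
  fix \<phi> assume \<phi>: "test_function \<phi>"
  have Sm [measurable]: "S \<in> borel_measurable borel"
    using S by (rule borel_measurable_continuous_onI)
  note [measurable] = g
  have \<phi>m: "\<phi> \<in> borel_measurable borel"
    using test_function_imp_continuous[OF \<phi>] by (rule borel_measurable_continuous_onI)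
  obtain B where B: "B > 0" "\<And>z. cmod (\<phi> z) \<le> B"
    using test_function_bounded[OF \<phi>] by metis
  obtain R where R: "R > 0" "\<And>z. z \<notin> ball 0 R \<Longrightarrow> \<phi> z = 0"
    using test_function_support_ball[OF \<phi>] by metis
  have intS: "integrable lborel (\<lambda>z. of_real (S z) * \<phi> z)"
    by (rule distribution_of_continuous(2)[OF S \<phi>])
  have step: "integrable lborel (\<lambda>z. of_real (g t z) * \<phi> z) \<and>
      dist (\<integral>z. of_real (g t z) * \<phi> z \<partial>lborel) (\<integral>z. of_real (S z) * \<phi> z \<partial>lborel) \<le> B * e"
    if t: "(\<integral>\<^sup>+z\<in>ball 0 R. ennreal \<bar>g t z - S z\<bar> \<partial>lborel) \<le> ennreal e" and e: "e > 0" for t e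
  proof -
    have m: "(\<lambda>z. g t z - S z) \<in> borel_measurable borel"
      by measurable
    note D = integral_times_bounded_le[OF m \<phi>m t less_imp_le[OF e] B(2) R(2)]
    have eq: "of_real (g t z) * \<phi> z = of_real (g t z - S z) * \<phi> z + of_real (S z) * \<phi> z" for z
      by (simp add: algebra_simps)
    have int: "integrable lborel (\<lambda>z. of_real (g t z) * \<phi> z)"
      unfolding eq by (intro Bochner_Integration.integrable_add D(1) intS)
    have "(\<integral>z. of_real (g t z) * \<phi> z \<partial>lborel) - (\<integral>z. of_real (S z) * \<phi> z \<partial>lborel)
        = (\<integral>z. of_real (g t z - S z) * \<phi> z \<partial>lborel)"
      by (subst Bochner_Integration.integral_diff[OF int intS, symmetric]) (simp add: algebra_simps)
    then show ?thesis
      using int D(2) by (simp add: dist_norm)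
  qed
  show "\<forall>\<^sub>F t in at_top. integrable lborel (\<lambda>z. of_real (g t z) * \<phi> z)"
    using conv[OF R(1) zero_less_one] by eventually_elim (use step[OF _ zero_less_one] in blast)
  show "((\<lambda>t. \<integral>z. of_real (g t z) * \<phi> z \<partial>lborel) \<longlongrightarrow> (\<integral>z. of_real (S z) * \<phi> z \<partial>lborel)) at_top"
  proof (rule tendstoI)
    fix e :: real assume e: "e > 0"
    have pos: "e / (2 * B) > 0"
      using e B by simp
    have lt: "B * (e / (2 * B)) < e"
      using e B by simp
    show "\<forall>\<^sub>F t in at_top. dist (\<integral>z. of_real (g t z) * \<phi> z \<partial>lborel) (\<integral>z. of_real (S z) * \<phi> z \<partial>lborel) < e"
      using conv[OF R(1) pos] by eventually_elim (use step[OF _ pos] lt in \<open>meson le_less_trans\<close>)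
  qed
qed

section \<open>Order, type and indicator\<close>

text \<open>The comparison function is \<open>Re (w\<^sup>2 - 2 s \<i> w)\<close>, which is at least 1 on the half circle, nonnegative
  on the diameter and small near its midpoint.\<close>

lemma two_constants_half_disc:
  fixes g :: "complex \<Rightarrow> complex"
  assumes g: "g holomorphic_on UNIV" and \<delta>: "\<delta> \<ge> 0" and s: "s = 1 \<or> s = (-1::real)"
    and disc: "\<And>w. cmod w \<le> 1 \<Longrightarrow> cmod (g w) \<le> exp A"
    and diam: "\<And>x. \<bar>x\<bar> \<le> 1 \<Longrightarrow> cmod (g (of_real x)) \<le> exp (A - \<delta>)"
    and w: "cmod w \<le> 1" "s * Im w \<ge> 0"
  shows "cmod (g w) \<le> exp (A - \<delta> + \<delta> * ((Re w)\<^sup>2 - (Im w)\<^sup>2 + 2 * s * Im w))"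
proof -
  define P where "P = (\<lambda>w::complex. (Re w)\<^sup>2 - (Im w)\<^sup>2 + 2 * s * Im w)"
  \<comment> \<open>|E| = exp (- \<delta> P): the product \<open>g w * E w\<close> is bounded by exp
    (A - \<delta>) on the circular arc because P >= 1 there, and on the diameter because P >= 0
    there.\<close>
  define E where "E = (\<lambda>w::complex. exp (- of_real \<delta> * (w\<^sup>2 - 2 * of_real s * \<i> * w)))"
  define T where "T = {w::complex. cmod w \<le> 1 \<and> s * Im w \<ge> 0}"
  have normE: "cmod (E w) = exp (- \<delta> * P w)" for w
    by (simp add: E_def P_def power2_eq_square)
  have hol: "(\<lambda>w. g w * E w) holomorphic_on UNIV"
    unfolding E_def by (intro holomorphic_intros g)
  have closed: "closed T"
    unfolding T_def by (intro closed_Collect_conj closed_Collect_le continuous_intros)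
  have "open {w::complex. cmod w < 1 \<and> s * Im w > 0}"
    by (intro open_Collect_conj open_Collect_less continuous_intros)
  then have int: "{w::complex. cmod w < 1 \<and> s * Im w > 0} \<subseteq> interior T"
    by (intro interior_maximal) (auto simp: T_def)
  have bd: "cmod (g z * E z) \<le> exp (A - \<delta>)" if "z \<in> frontier T" for z
  proof -
    have zT: "cmod z \<le> 1" "s * Im z \<ge> 0" and "z \<notin> interior T"
      using that closed by (auto simp: frontier_def T_def)
    \<comment> \<open>A point of T with both defining inequalities strict is interior, so the
      frontier lies on the real line or the unit circle.\<close>
    then consider "Im z = 0" | "cmod z = 1"
      using int s by (smt (verit, best) mem_Collect_eq mult_eq_0_iff subsetD)
    then show ?thesis
    proof cases
      case 1
      then have z: "z = of_real (Re z)" "\<bar>Re z\<bar> \<le> 1"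
        using zT abs_Re_le_cmod[of z] by (auto simp: complex_eq_iff)
      have "cmod (g z) \<le> exp (A - \<delta>)"
        using diam[OF z(2)] z(1) by simp
      moreover have "cmod (E z) \<le> 1"
        using 1 \<delta> by (simp add: normE P_def)
      ultimately have "cmod (g z) * cmod (E z) \<le> exp (A - \<delta>) * 1"
        by (intro mult_mono) auto
      then show ?thesis
        by (simp add: norm_mult)
    next
      case 2
      let ?y = "s * Im z"
      have "?y \<le> 1"
        using abs_Im_le_cmod[of z] 2 s by auto
      have "(Re z)\<^sup>2 + (Im z)\<^sup>2 = 1"
        using 2 by (metis cmod_power2 one_power2)
      \<comment> \<open>Substitute (Re z)^2 = 1 - y^2 with y = s Im z; here s^2 = 1.\<close>
      then have "P z = 1 + 2 * (?y * (1 - ?y))"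
        using s unfolding P_def by (auto simp: algebra_simps power2_eq_square)
      moreover have "?y * (1 - ?y) \<ge> 0"
        using zT \<open>?y \<le> 1\<close> mult_nonneg_nonneg[of ?y "1 - ?y"] by auto
      ultimately have "P z \<ge> 1"
        by simp
      then have "\<delta> * P z \<ge> \<delta> * 1"
        using \<delta> by (intro mult_left_mono)
      then have "cmod (E z) \<le> exp (- \<delta>)"
        by (simp add: normE)
      then have "cmod (g z) * cmod (E z) \<le> exp A * exp (- \<delta>)"
        using disc[of z] 2 by (intro mult_mono) auto
      then show ?thesis
        by (simp add: norm_mult exp_diff exp_minus field_simps)
    qed
  qed
  have bounded: "bounded T"
    by (rule bounded_subset[OF bounded_cball[of 0 1]]) (auto simp: T_def)
  have cont: "continuous_on (closure T) (\<lambda>w. g w * E w)"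
    using hol by (meson continuous_on_subset holomorphic_on_imp_continuous_on top_greatest)
  have hol': "(\<lambda>w. g w * E w) holomorphic_on interior T"
    using hol by (rule holomorphic_on_subset) simp
  have "w \<in> T"
    using w by (simp add: T_def)
  with hol' cont bounded bd have "cmod (g w * E w) \<le> exp (A - \<delta>)"
    by (rule maximum_modulus_frontier)
  then have "cmod (g w) * exp (- \<delta> * P w) * exp (\<delta> * P w) \<le> exp (A - \<delta>) * exp (\<delta> * P w)"
    by (intro mult_right_mono) (auto simp: norm_mult normE)
  then show ?thesis
    by (simp add: P_def mult.assoc flip: exp_add)
qed

text \<open>Apply the half disc estimate on the side containing w. For |w| <= 1/8 the comparison
  function is at most 1/64 + 1/4, hence below 1/2, so half of the gain \<delta> survives.\<close>

lemma two_constants_disc: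
  fixes g :: "complex \<Rightarrow> complex"
  assumes g: "g holomorphic_on UNIV" and \<delta>: "\<delta> \<ge> 0"
    and disc: "\<And>w. cmod w \<le> 1 \<Longrightarrow> cmod (g w) \<le> exp A"
    and diam: "\<And>x. \<bar>x\<bar> \<le> 1 \<Longrightarrow> cmod (g (of_real x)) \<le> exp (A - \<delta>)"
    and w: "cmod w \<le> 1 / 8"
  shows "cmod (g w) \<le> exp (A - \<delta> / 2)"
proof -
  define s :: real where "s = (if Im w \<ge> 0 then 1 else -1)"
  have "(Re w)\<^sup>2 \<le> (cmod w)\<^sup>2"
    by (simp add: cmod_power2)
  also have "\<dots> \<le> (1 / 8)\<^sup>2"
    using w by (intro power_mono) auto
  finally have 1: "(Re w)\<^sup>2 \<le> 1 / 64"
    by (simp add: power2_eq_square)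
  have "s * Im w \<le> 1 / 8" "s * Im w \<ge> 0"
    using abs_Im_le_cmod[of w] w by (auto simp: s_def)
  moreover have "(Im w)\<^sup>2 \<ge> 0"
    by simp
  ultimately have "(Re w)\<^sup>2 - (Im w)\<^sup>2 + 2 * s * Im w \<le> 1 / 2"
    using 1 by linarith
  then have "\<delta> * ((Re w)\<^sup>2 - (Im w)\<^sup>2 + 2 * s * Im w) \<le> \<delta> * (1 / 2)"
    using \<delta> by (intro mult_left_mono)
  moreover have "cmod (g w) \<le> exp (A - \<delta> + \<delta> * ((Re w)\<^sup>2 - (Im w)\<^sup>2 + 2 * s * Im w))"
    using w \<open>s * Im w \<ge> 0\<close> by (intro two_constants_half_disc g \<delta> disc diam) (auto simp: s_def)
  ultimately show ?thesis
    by (elim order_trans) simp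
qed

section \<open>Indicator, order and type from exponential bounds\<close>

lemma powr_times_log_ereal_le_iff:
  assumes "r > 0" "y \<ge> 0"
  shows "ereal (r powr (-\<rho>)) * log_ereal y \<le> ereal x \<longleftrightarrow> y \<le> exp (x * r powr \<rho>)"
proof (cases "y = 0")
  case True
  \<comment> \<open>Both sides are true: the left one is minus infinity, the exponential on the
    right is positive.\<close>
  then show ?thesis
    using assms by (simp add: log_ereal_def)
next
  case False
  have "ereal (r powr (-\<rho>)) * log_ereal y \<le> ereal x \<longleftrightarrow> r powr (-\<rho>) * ln y \<le> x"
    using False by (simp add: log_ereal_def)
  also have "\<dots> \<longleftrightarrow> ln y \<le> x * r powr \<rho>"
    using assms by (simp add: powr_minus field_simps)
  also have "\<dots> \<longleftrightarrow> y \<le> exp (x * r powr \<rho>)"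
    using False assms by (metis exp_gt_zero ln_exp ln_le_cancel_iff order_le_less)
  finally show ?thesis .
qed

text \<open>If the indicator were below y < \<sigma>, a disc with its diameter on the ray would push
  the exponent near its centre down to about (\<sigma> + y) / 2, whereas \<open>dense\<close>
  supplies a point there with exponent about \<sigma>. The number \<kappa> is both the radius of the
  disc and the tolerance, and tends to 0 at the end.\<close>

lemma indicator_eq:
  fixes f :: "complex \<Rightarrow> complex"
  assumes f: "f holomorphic_on UNIV" and \<rho>: "\<rho> > 0" and \<sigma>: "\<sigma> > 0"
    and upper: "\<And>\<epsilon>. \<epsilon> > 0 \<Longrightarrow> \<forall>\<^sub>F r in at_top. \<forall>z. cmod z = r \<longrightarrow> cmod (f z) \<le> exp ((\<sigma> + \<epsilon>) * r powr \<rho>)"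
    and scaled: "\<And>R e. R > 0 \<Longrightarrow> e > 0 \<Longrightarrow> \<forall>\<^sub>F t in at_top. \<forall>z\<in>cball 0 R.
           cmod (f (of_real t * z)) \<le> exp (t powr \<rho> * (\<sigma> * cmod z powr \<rho> + e))"
    and dense: "\<And>w \<eta> \<epsilon>. \<eta> > 0 \<Longrightarrow> \<epsilon> > 0 \<Longrightarrow> \<forall>\<^sub>F t in at_top. \<exists>z\<in>cball w \<eta>.
          exp (t powr \<rho> * (\<sigma> * cmod z powr \<rho> - \<epsilon>)) \<le> cmod (f (of_real t * z))"
  shows "indicator_fun \<rho> f \<theta> = ereal \<sigma>"
proof (rule antisym)
  let ?h = "\<lambda>r. ereal (r powr (-\<rho>)) * log_ereal (cmod (f (of_real r * cis \<theta>)))"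
  show "indicator_fun \<rho> f \<theta> \<le> ereal \<sigma>"
  proof (rule ereal_le_epsilon2)
    fix \<epsilon> :: real assume \<epsilon>: "\<epsilon> > 0"
    have "\<forall>\<^sub>F r in at_top. ?h r \<le> ereal (\<sigma> + \<epsilon>)"
      using upper[OF \<epsilon>] eventually_gt_at_top[of 0]
      by eventually_elim (simp add: powr_times_log_ereal_le_iff norm_mult)
    then have "indicator_fun \<rho> f \<theta> \<le> ereal (\<sigma> + \<epsilon>)"
      unfolding indicator_fun_def by (rule Limsup_bounded)
    then show "indicator_fun \<rho> f \<theta> \<le> ereal \<sigma> + ereal \<epsilon>"
      by simp
  qed
  show "ereal \<sigma> \<le> indicator_fun \<rho> f \<theta>"
  proof (rule ccontr)
    assume "\<not> ereal \<sigma> \<le> indicator_fun \<rho> f \<theta>"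
    \<comment> \<open>The indicator may be negative or minus infinity; a positive y makes y r^\<rho>
      increasing in r, as the bound on the diameter requires.\<close>
    then have "max (indicator_fun \<rho> f \<theta>) 0 < ereal \<sigma>"
      using \<sigma> by simp
    then obtain y where y: "indicator_fun \<rho> f \<theta> < ereal y" "0 < y" "y < \<sigma>"
      using ereal_dense2 by (metis ereal_less(2) ereal_less_eq(3) less_ereal.simps(1) max_less_iff_conj)
    have "\<forall>\<^sub>F r in at_top. ?h r < ereal y"
      using y(1) unfolding indicator_fun_def by (rule Limsup_lessD)
    then have "\<forall>\<^sub>F r in at_top. cmod (f (of_real r * cis \<theta>)) \<le> exp (y * r powr \<rho>)"
      using eventually_gt_at_top[of 0]
    proof eventually_elim
      case (elim r)
      then have "?h r \<le> ereal y"
        by simp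
      then show ?case
        using elim by (subst (asm) powr_times_log_ereal_le_iff) auto
    qed
    then obtain r0 where r0: "\<And>r. r \<ge> r0 \<Longrightarrow> cmod (f (of_real r * cis \<theta>)) \<le> exp (y * r powr \<rho>)"
      unfolding eventually_at_top_linorder by blast
    have key: "\<sigma> * (1 - \<kappa>) powr \<rho> - \<kappa> \<le> ((\<sigma> + y) * (1 + \<kappa>) powr \<rho> + \<kappa>) / 2"
      if \<kappa>: "0 < \<kappa>" "\<kappa> < 1" for \<kappa> :: real
    proof -
      \<comment> \<open>Distance at most \<kappa> / 8 from the centre becomes |w| <= 1/8 after
        rescaling the disc of radius \<kappa>.\<close>
      have k8: "\<kappa> / 8 > 0"
        using \<kappa> by simp
      have scaled2: "\<forall>\<^sub>F t in at_top. \<forall>z. cmod z \<le> 2 \<longrightarrow>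
          cmod (f (of_real t * z)) \<le> exp (t powr \<rho> * (\<sigma> * cmod z powr \<rho> + \<kappa>))"
        using scaled[of 2 \<kappa>] \<kappa> by (simp add: Ball_def)
      have "filterlim (\<lambda>t. t * (1 - \<kappa>)) at_top at_top"
        using \<kappa> by real_asymp
      then have "\<forall>\<^sub>F t in at_top. r0 \<le> t * (1 - \<kappa>)"
        by (simp add: filterlim_at_top)
      then have "\<forall>\<^sub>F t::real in at_top. \<sigma> * (1 - \<kappa>) powr \<rho> - \<kappa> \<le> ((\<sigma> + y) * (1 + \<kappa>) powr \<rho> + \<kappa>) / 2"
        using eventually_gt_at_top[of 0] dense[OF k8 \<kappa>(1), of "cis \<theta>"] scaled2
      proof eventually_elim
        case (elim t)
        obtain z where z: "z \<in> cball (cis \<theta>) (\<kappa> / 8)"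
          "exp (t powr \<rho> * (\<sigma> * cmod z powr \<rho> - \<kappa>)) \<le> cmod (f (of_real t * z))"
          using elim by blast
        \<comment> \<open>The coordinate w maps [-1, 1] into the ray of angle \<theta>.\<close>
        define g where "g = (\<lambda>w. f (of_real t * (cis \<theta> + of_real \<kappa> * cis \<theta> * w)))"
        define A where "A = t powr \<rho> * (\<sigma> * (1 + \<kappa>) powr \<rho> + \<kappa>)"
        \<comment> \<open>Chosen so that A - \<delta> is the exponent which the assumed ray bound
          gives at the far end of the diameter.\<close>
        define \<delta> where "\<delta> = t powr \<rho> * ((\<sigma> - y) * (1 + \<kappa>) powr \<rho> + \<kappa>)"
        have A\<delta>: "A - \<delta> = t powr \<rho> * (y * (1 + \<kappa>) powr \<rho>)"
          by (simp add: A_def \<delta>_def algebra_simps)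
        have \<delta>0: "\<delta> \<ge> 0"
          using y \<kappa> unfolding \<delta>_def by (intro mult_nonneg_nonneg add_nonneg_nonneg) auto
        define w where "w = (z - cis \<theta>) / (of_real \<kappa> * cis \<theta>)"
        have zw: "z = cis \<theta> + of_real \<kappa> * cis \<theta> * w"
          using \<kappa> by (simp add: w_def)
        have nw: "cmod w \<le> 1 / 8"
          using z(1) \<kappa> by (simp add: w_def norm_divide norm_mult dist_norm norm_minus_commute field_simps)
        have hol: "g holomorphic_on UNIV"
            unfolding g_def using holomorphic_on_compose_gen[OF _ f, of "\<lambda>w. of_real t * (cis \<theta> + of_real \<kappa> * cis \<theta> * w)" UNIV]
            by (simp add: o_def holomorphic_intros)
        have disc: "cmod (g w) \<le> exp A" if w: "cmod w \<le> 1" for w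
          proof -
            let ?z = "cis \<theta> + of_real \<kappa> * cis \<theta> * w"
            have "cmod ?z \<le> 1 + cmod (of_real \<kappa> * cis \<theta> * w)"
              using norm_triangle_ineq[of "cis \<theta>" "of_real \<kappa> * cis \<theta> * w"] by simp
            also have "\<dots> \<le> 1 + \<kappa> * 1"
              using \<kappa> w by (simp add: norm_mult)
            finally have nz: "cmod ?z \<le> 1 + \<kappa>"
              by simp
            then have "cmod (g w) \<le> exp (t powr \<rho> * (\<sigma> * cmod ?z powr \<rho> + \<kappa>))"
              unfolding g_def using elim(4) \<kappa>(2) by auto
            also have "\<dots> \<le> exp A"
              unfolding A_def exp_le_cancel_iff using nz \<rho> \<sigma>
              by (intro mult_left_mono add_right_mono powr_mono2) auto
            finally show ?thesis .
          qed
        have diam: "cmod (g (of_real x)) \<le> exp (A - \<delta>)" if x: "\<bar>x\<bar> \<le> 1" for x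
          proof -
            have "\<kappa> * \<bar>x\<bar> \<le> \<kappa> * 1"
              using x \<kappa> by (intro mult_left_mono) auto
            then have \<kappa>x: "\<bar>\<kappa> * x\<bar> \<le> \<kappa>"
              using \<kappa> by (simp add: abs_mult)
            have eq: "of_real t * (cis \<theta> + of_real \<kappa> * cis \<theta> * of_real x) = of_real (t * (1 + \<kappa> * x)) * cis \<theta>"
              by (simp add: algebra_simps)
            have "t * (1 - \<kappa>) \<le> t * (1 + \<kappa> * x)"
              using elim \<kappa>x by (intro mult_left_mono) auto
            then have "cmod (g (of_real x)) \<le> exp (y * (t * (1 + \<kappa> * x)) powr \<rho>)"
              unfolding g_def eq using elim by (intro r0) linarith
            also have "\<dots> \<le> exp (y * (t * (1 + \<kappa>)) powr \<rho>)"
              unfolding exp_le_cancel_iff using elim \<kappa>x \<kappa> y \<rho>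
              by (intro mult_left_mono powr_mono2) (auto simp: abs_le_iff)
            also have "\<dots> = exp (A - \<delta>)"
              using elim \<kappa> by (simp add: A\<delta> powr_mult mult_ac)
            finally show ?thesis .
          qed
        have "cmod (g w) \<le> exp (A - \<delta> / 2)"
          using hol \<delta>0 disc diam nw by (rule two_constants_disc)
        then have "exp (t powr \<rho> * (\<sigma> * cmod z powr \<rho> - \<kappa>)) \<le> exp (A - \<delta> / 2)"
          using z(2) unfolding g_def zw[symmetric] by linarith
        moreover have "A - \<delta> / 2 = t powr \<rho> * (((\<sigma> + y) * (1 + \<kappa>) powr \<rho> + \<kappa>) / 2)"
          by (simp add: A_def \<delta>_def field_simps)
        ultimately have le: "\<sigma> * cmod z powr \<rho> - \<kappa> \<le> ((\<sigma> + y) * (1 + \<kappa>) powr \<rho> + \<kappa>) / 2"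
          using elim by simp
        have "1 - \<kappa> \<le> cmod z"
          using z(1) norm_triangle_ineq2[of "cis \<theta>" z] \<kappa> by (simp add: dist_norm)
        then have "\<sigma> * (1 - \<kappa>) powr \<rho> \<le> \<sigma> * cmod z powr \<rho>"
          using \<kappa> \<rho> \<sigma> by (intro mult_left_mono powr_mono2) auto
        then show ?case
          using le by linarith
      qed
      \<comment> \<open>The inequality does not involve t, and \<open>at_top\<close> is a proper
        filter.\<close>
      then show ?thesis
        by simp
    qed
    have l1: "((\<lambda>\<kappa>. \<sigma> * (1 - \<kappa>) powr \<rho> - \<kappa>) \<longlongrightarrow> \<sigma> * (1 - 0) powr \<rho> - 0) (at_right 0)"
      by (intro tendsto_intros) auto
    have l2: "((\<lambda>\<kappa>. ((\<sigma> + y) * (1 + \<kappa>) powr \<rho> + \<kappa>) / 2) \<longlongrightarrow> ((\<sigma> + y) * (1 + 0) powr \<rho> + 0) / 2) (at_right 0)"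
      by (intro tendsto_intros) auto
    have "\<forall>\<^sub>F \<kappa> in at_right 0. \<sigma> * (1 - \<kappa>) powr \<rho> - \<kappa> \<le> ((\<sigma> + y) * (1 + \<kappa>) powr \<rho> + \<kappa>) / 2"
      using eventually_at_right_real[OF zero_less_one] by eventually_elim (rule key; simp)
    then have "\<sigma> * (1 - 0) powr \<rho> - 0 \<le> ((\<sigma> + y) * (1 + 0) powr \<rho> + 0) / 2"
      by (rule tendsto_le[OF trivial_limit_at_right_real l2 l1])
    then show False
      using y by simp
  qed
qed

text \<open>The bounds hold on both sides for all large r, so the upper limits are limits and a
  sandwich suffices. Once \<sigma> r^\<rho> / 2 >= 1, the truncations in \<open>entire_order\<close>
  are inactive.\<close>

lemma order_and_type:
  fixes f :: "complex \<Rightarrow> complex"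
  assumes \<rho>: "\<rho> > 0" and \<sigma>: "\<sigma> > 0"
    and upper: "\<And>\<epsilon>. \<epsilon> > 0 \<Longrightarrow> \<forall>\<^sub>F r in at_top. \<forall>z. cmod z = r \<longrightarrow> cmod (f z) \<le> exp ((\<sigma> + \<epsilon>) * r powr \<rho>)"
    and lower: "\<And>\<epsilon>. \<epsilon> > 0 \<Longrightarrow> \<forall>\<^sub>F r in at_top. \<exists>z. cmod z = r \<and> exp ((\<sigma> - \<epsilon>) * r powr \<rho>) \<le> cmod (f z)"
  shows "entire_order f = ereal \<rho>" and "normal_type \<rho> f"
proof -
  define M where "M = max_modulus f"
  have M: "\<forall>\<^sub>F r in at_top. r > 1 \<and> M r > 0 \<and> (\<sigma> - \<epsilon>) * r powr \<rho> \<le> ln (M r) \<and> ln (M r) \<le> (\<sigma> + \<epsilon>) * r powr \<rho>"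
    if \<epsilon>: "\<epsilon> > 0" for \<epsilon>
    using upper[OF \<epsilon>] lower[OF \<epsilon>] eventually_gt_at_top[of 1]
  proof eventually_elim
    case (elim r)
    then obtain z where z: "cmod z = r" "exp ((\<sigma> - \<epsilon>) * r powr \<rho>) \<le> cmod (f z)"
      by blast
    have "cmod (f z) \<le> M r"
      unfolding M_def max_modulus_def using elim z by (intro cSUP_upper bdd_aboveI2) auto
    then have 1: "exp ((\<sigma> - \<epsilon>) * r powr \<rho>) \<le> M r"
      using z by linarith
    have 2: "M r \<le> exp ((\<sigma> + \<epsilon>) * r powr \<rho>)"
      unfolding M_def max_modulus_def using elim z by (intro cSUP_least) auto
    have 3: "M r > 0"
      using 1 by (meson exp_gt_zero less_le_trans)
    show ?case
      using ln_mono[OF 1] ln_mono[OF 2] 3 elim by simp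
  qed
  have half: "\<sigma> / 2 > 0"
    using \<sigma> by simp
  have lim: "((\<lambda>r. r powr (-\<rho>) * ln (M r)) \<longlongrightarrow> \<sigma>) at_top"
  proof (rule tendstoI)
    fix e :: real assume "e > 0"
    then have "e / 2 > 0"
      by simp
    from M[OF this] show "\<forall>\<^sub>F r in at_top. dist (r powr (-\<rho>) * ln (M r)) \<sigma> < e"
    proof eventually_elim
      case (elim r)
      have inv: "r powr (-\<rho>) * r powr \<rho> = 1"
        using elim by (simp flip: powr_add)
      have "r powr (-\<rho>) * ((\<sigma> - e / 2) * r powr \<rho>) \<le> r powr (-\<rho>) * ln (M r)"
           "r powr (-\<rho>) * ln (M r) \<le> r powr (-\<rho>) * ((\<sigma> + e / 2) * r powr \<rho>)"
        using elim by (intro mult_left_mono; simp)+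
      then show ?case
        using inv \<open>e > 0\<close> by (simp add: mult.left_commute[of "r powr (-\<rho>)"] dist_real_def abs_less_iff)
    qed
  qed
  have "Limsup at_top (\<lambda>r. ereal (r powr (-\<rho>)) * log_ereal (M r)) = ereal \<sigma>"
  proof (rule lim_imp_Limsup)
    have "((\<lambda>r. ereal (r powr (-\<rho>) * ln (M r))) \<longlongrightarrow> ereal \<sigma>) at_top"
      using lim by simp
    moreover have "\<forall>\<^sub>F r in at_top. ereal (r powr (-\<rho>) * ln (M r)) = ereal (r powr (-\<rho>)) * log_ereal (M r)"
      using M[OF half] by eventually_elim (auto simp: log_ereal_def)
    ultimately show "((\<lambda>r. ereal (r powr (-\<rho>)) * log_ereal (M r)) \<longlongrightarrow> ereal \<sigma>) at_top"
      by (rule Lim_transform_eventually)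
  qed auto
  then show "normal_type \<rho> f"
    using \<sigma> by (simp add: normal_type_def M_def)
  have "((\<lambda>r. ln (max 1 (ln (max 1 (M r)))) / ln r) \<longlongrightarrow> \<rho>) at_top"
  proof (rule tendsto_sandwich)
    have "filterlim (\<lambda>r. \<sigma> / 2 * r powr \<rho>) at_top at_top"
      using \<sigma> \<rho> by real_asymp
    then have "\<forall>\<^sub>F r in at_top. 1 \<le> \<sigma> / 2 * r powr \<rho>"
      unfolding filterlim_at_top by blast
    with M[OF half] have ev: "\<forall>\<^sub>F r in at_top. ln (\<sigma> / 2 * r powr \<rho>) / ln r \<le> ln (max 1 (ln (max 1 (M r)))) / ln r
        \<and> ln (max 1 (ln (max 1 (M r)))) / ln r \<le> ln (2 * \<sigma> * r powr \<rho>) / ln r"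
    proof eventually_elim
      case (elim r)
      have a: "\<sigma> / 2 * r powr \<rho> \<le> ln (M r)"
        using elim by (simp add: algebra_simps)
      have "\<sigma> * r powr \<rho> \<ge> 0"
        using \<sigma> by simp
      then have b: "ln (M r) \<le> 2 * \<sigma> * r powr \<rho>"
        using elim by (simp add: algebra_simps)
      have c: "1 \<le> ln (M r)"
        using a elim by linarith
      then have "M r > 1"
        using elim by (metis ln_gt_zero_iff less_le_trans zero_less_one)
      then have "max 1 (ln (max 1 (M r))) = ln (M r)"
        using c by simp
      moreover have "ln (\<sigma> / 2 * r powr \<rho>) \<le> ln (ln (M r))" "ln (ln (M r)) \<le> ln (2 * \<sigma> * r powr \<rho>)"
        using a b c elim by (intro ln_mono; linarith)+
      ultimately show ?case
        using elim by (auto intro!: divide_right_mono)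
    qed
    show "\<forall>\<^sub>F r in at_top. ln (\<sigma> / 2 * r powr \<rho>) / ln r \<le> ln (max 1 (ln (max 1 (M r)))) / ln r"
      using ev by eventually_elim simp
    show "\<forall>\<^sub>F r in at_top. ln (max 1 (ln (max 1 (M r)))) / ln r \<le> ln (2 * \<sigma> * r powr \<rho>) / ln r"
      using ev by eventually_elim simp
    show "((\<lambda>r. ln (\<sigma> / 2 * r powr \<rho>) / ln r) \<longlongrightarrow> \<rho>) at_top"
      using \<sigma> \<rho> by real_asymp
    show "((\<lambda>r. ln (2 * \<sigma> * r powr \<rho>) / ln r) \<longlongrightarrow> \<rho>) at_top"
      using \<sigma> \<rho> by real_asymp
  qed
  then have "((\<lambda>r. ereal (ln (max 1 (ln (max 1 (M r)))) / ln r)) \<longlongrightarrow> ereal \<rho>) at_top"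
    by simp
  then show "entire_order f = ereal \<rho>"
    unfolding entire_order_def M_def by (intro lim_imp_Limsup) auto
qed

section \<open>Locality of multipliers of minimal exponential type\<close>

text \<open>The upper limit controls h only for large |z|; the constant accounts for the remaining
  disc and turns the estimate into a global one.\<close>

lemma minimal_exponential_type_bound:
  assumes h: "minimal_exponential_type h" and \<epsilon>: "\<epsilon> > 0"
  obtains C where "C > 0" "\<And>z. cmod (h z) \<le> C * exp (\<epsilon> * cmod z)"
proof -
  have hol: "h holomorphic_on UNIV"
    using h by (simp add: minimal_exponential_type_def)
  have "Limsup at_infinity (\<lambda>z. ereal (1 / cmod z) * log_ereal (cmod (h z))) < ereal \<epsilon>"
    using h \<epsilon> unfolding minimal_exponential_type_def by (metis ereal_less(2) le_less_trans)
  then have "\<forall>\<^sub>F z in at_infinity. ereal (1 / cmod z) * log_ereal (cmod (h z)) < ereal \<epsilon>"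
    by (rule Limsup_lessD)
  then obtain b where b: "\<And>z. b \<le> cmod z \<Longrightarrow> ereal (1 / cmod z) * log_ereal (cmod (h z)) < ereal \<epsilon>"
    unfolding eventually_at_infinity by blast
  have far: "cmod (h z) \<le> exp (\<epsilon> * cmod z)" if z: "max b 1 \<le> cmod z" for z
  proof -
    have "ereal (cmod z powr (- 1)) * log_ereal (cmod (h z)) \<le> ereal \<epsilon>"
      using b[of z] z by (simp add: powr_minus powr_one inverse_eq_divide less_imp_le)
    then have "cmod (h z) \<le> exp (\<epsilon> * cmod z powr 1)"
      using z by (subst (asm) powr_times_log_ereal_le_iff) auto
    then show ?thesis
      using z by (simp add: powr_one)
  qed
  have "bounded (h ` cball 0 (max b 1))"
    by (intro compact_imp_bounded compact_continuous_image holomorphic_on_imp_continuous_on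
        holomorphic_on_subset[OF hol]) auto
  then obtain B where B: "B > 0" "\<And>z. cmod z \<le> max b 1 \<Longrightarrow> cmod (h z) \<le> B"
    by (auto simp: bounded_pos)
  have "cmod (h z) \<le> (B + 1) * exp (\<epsilon> * cmod z)" for z
  proof (cases "max b 1 \<le> cmod z")
    case True
    then have "cmod (h z) \<le> 1 * exp (\<epsilon> * cmod z)"
      using far by simp
    also have "\<dots> \<le> (B + 1) * exp (\<epsilon> * cmod z)"
      using B by (intro mult_right_mono) auto
    finally show ?thesis .
  next
    case False
    then have "cmod z \<le> max b 1"
      by linarith
    then have "cmod (h z) \<le> (B + 1) * 1"
      using B(2)[of z] by simp
    also have "\<dots> \<le> (B + 1) * exp (\<epsilon> * cmod z)"
      using B \<epsilon> by (intro mult_left_mono) auto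
    finally show ?thesis .
  qed
  then show ?thesis
    using B by (intro that[of "B + 1"]) auto
qed

text \<open>Cauchy's inequality on the radius k / \<epsilon>, which minimises exp (\<epsilon> R) /
  R^k; then k! <= k^k cancels the power of k. For k = 0 that radius degenerates, and the bound is
  read off at 0.\<close>

lemma higher_deriv_bound_of_exponential_type:
  fixes h :: "complex \<Rightarrow> complex"
  assumes hol: "h holomorphic_on UNIV" and \<epsilon>: "\<epsilon> > 0" and C: "C > 0"
    and bound: "\<And>z. cmod (h z) \<le> C * exp (\<epsilon> * cmod z)"
  shows "cmod ((deriv ^^ k) h 0) \<le> C * (exp 1 * \<epsilon>) ^ k"
proof (cases "k = 0")
  case True
  then show ?thesis
    using bound[of 0] by simp
next
  case False
  define R where "R = k / \<epsilon>"
  have R: "R > 0"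
    using False \<epsilon> by (simp add: R_def)
  have "cmod ((deriv ^^ k) h 0) \<le> fact k * (C * exp (\<epsilon> * R)) / R ^ k"
  proof (rule Cauchy_inequality)
    show "h holomorphic_on ball 0 R"
      using hol by (rule holomorphic_on_subset) simp
    show "continuous_on (cball 0 R) h"
      using holomorphic_on_imp_continuous_on[OF hol] by (rule continuous_on_subset) simp
    show "cmod (h x) \<le> C * exp (\<epsilon> * R)" if "cmod (0 - x) = R" for x
      using bound[of x] that by simp
  qed (rule R)
  also have "\<dots> \<le> real k ^ k * (C * exp (\<epsilon> * R)) / R ^ k"
    using fact_le_power[of k, where 'a = real] R C by (intro divide_right_mono mult_right_mono) auto
  also have "\<dots> = C * (exp 1 * \<epsilon>) ^ k"
    using False \<epsilon> by (simp add: R_def power_mult_distrib power_divide exp_of_nat_mult[of k 1, simplified] field_simps)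
  finally show ?thesis .
qed

lemma higher_deriv_exponential_sum:
  assumes "finite I"
  shows "(deriv ^^ k) (\<lambda>s. \<Sum>n\<in>I. A n * exp (m n * s)) = (\<lambda>s::complex. \<Sum>n\<in>I. A n * m n ^ k * exp (m n * s))"
proof (induction k)
  case (Suc k)
  have "((\<lambda>s. \<Sum>n\<in>I. A n * m n ^ k * exp (m n * s)) has_field_derivative
        (\<Sum>n\<in>I. A n * m n ^ Suc k * exp (m n * s))) (at s)" for s
    by (auto intro!: derivative_eq_intros sum.cong simp: mult_ac)
  then show ?case
    by (auto simp: Suc.IH intro!: DERIV_imp_deriv)
qed simp

text \<open>Expanding h in its Taylor series at 0 writes the left-hand sum as h(d/ds) applied to the
  exponential sum G at s = 0. Type \<delta> / (2 e) makes the k-th Taylor derivative of h at most C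
  (\<delta> / 2)^k, while Cauchy gives k! B / \<delta>^k for G; the ratio 1/2 sums to the factor
  2.\<close>

lemma multiplier_polynomial_bound:
  fixes h :: "complex \<Rightarrow> complex"
  assumes hol: "h holomorphic_on UNIV" and \<delta>: "\<delta> > 0" and C: "C > 0"
    and bound: "\<And>z. cmod (h z) \<le> C * exp (\<delta> / (2 * exp 1) * cmod z)"
    and I: "finite I"
    and B: "\<And>s. cmod s = \<delta> \<Longrightarrow> cmod (\<Sum>n\<in>I. A n * exp (m n * s)) \<le> B"
  shows "cmod (\<Sum>n\<in>I. A n * h (m n)) \<le> 2 * C * B"
proof -
  define G where "G = (\<lambda>s. \<Sum>n\<in>I. A n * exp (m n * s))"
  have holG: "G holomorphic_on S" for S
    unfolding G_def by (intro holomorphic_intros)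
  have derivG: "(deriv ^^ k) G 0 = (\<Sum>n\<in>I. A n * m n ^ k)" for k
    unfolding G_def by (subst higher_deriv_exponential_sum[OF I]) simp
  have G_bound: "cmod ((deriv ^^ k) G 0) \<le> fact k * B / \<delta> ^ k" for k
    using B by (intro Cauchy_inequality holG holomorphic_on_imp_continuous_on \<delta>) (auto simp: G_def)
  have h_bound: "cmod ((deriv ^^ k) h 0) \<le> C * (\<delta> / 2) ^ k" for k
    using higher_deriv_bound_of_exponential_type[OF hol _ C bound] \<delta> by simp
  have B0: "B \<ge> 0"
    using order_trans[OF norm_ge_zero B[of "of_real \<delta>"]] \<delta> by simp
  have "(\<lambda>k. (deriv ^^ k) h 0 / fact k * w ^ k) sums h w" for w
    using holomorphic_power_series[of h 0 "cmod w + 1" w] holomorphic_on_subset[OF hol] by auto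
  then have "(\<lambda>k. \<Sum>n\<in>I. A n * ((deriv ^^ k) h 0 / fact k * m n ^ k)) sums (\<Sum>n\<in>I. A n * h (m n))"
    by (intro sums_sum sums_mult)
  moreover have "(\<Sum>n\<in>I. A n * ((deriv ^^ k) h 0 / fact k * m n ^ k)) = (deriv ^^ k) h 0 / fact k * (deriv ^^ k) G 0" for k
    by (simp add: derivG sum_distrib_left mult_ac)
  ultimately have sums: "(\<lambda>k. (deriv ^^ k) h 0 / fact k * (deriv ^^ k) G 0) sums (\<Sum>n\<in>I. A n * h (m n))"
    by simp
  have "(\<lambda>k. C * B * (1 / 2) ^ k) sums (C * B * 2)"
    using geometric_sums[of "1 / 2 :: real"] by (intro sums_mult) simp
  moreover have "norm ((deriv ^^ k) h 0 / fact k * (deriv ^^ k) G 0) \<le> C * B * (1 / 2) ^ k" for k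
  proof -
    have "norm ((deriv ^^ k) h 0 / fact k * (deriv ^^ k) G 0)
        = norm ((deriv ^^ k) h 0) / fact k * norm ((deriv ^^ k) G 0)"
      by (simp add: norm_mult norm_divide)
    also have "\<dots> \<le> C * (\<delta> / 2) ^ k / fact k * (fact k * B / \<delta> ^ k)"
      using C \<delta> by (intro mult_mono divide_right_mono h_bound G_bound) auto
    also have "\<dots> = C * B * (1 / 2) ^ k"
      using \<delta> by (simp add: power_divide)
    finally show ?thesis .
  qed
  ultimately have "norm (\<Sum>n\<in>I. A n * h (m n)) \<le> C * B * 2"
    using norm_sums_le[OF sums] by blast
  then show ?thesis
    by (simp add: mult_ac)
qed

text \<open>On \<open>\<zeta> = ln z\<close> the multiplier acts as the infinite order differential operator \<open>h(d/d\<zeta> + 1)\<close>;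
  minimal type makes it local.\<close>

lemma multiplier_local_bound:
  fixes h :: "complex \<Rightarrow> complex" and a :: "nat \<Rightarrow> complex"
  assumes h: "minimal_exponential_type h" and \<delta>: "\<delta> > 0"
    and abs: "\<And>r. r > 0 \<Longrightarrow> summable (\<lambda>n. cmod (a n) * r ^ n)"
  shows "\<exists>C>0. \<forall>z T B. (\<lambda>n. a n * h (of_nat (Suc n)) * z ^ n) sums T \<longrightarrow>
       (\<forall>s. cmod s = \<delta> \<longrightarrow> cmod (\<Sum>n. a n * (z * exp s) ^ n) \<le> B) \<longrightarrow> cmod T \<le> C * B"
proof -
  have hol: "h holomorphic_on UNIV"
    using h by (simp add: minimal_exponential_type_def)
  have "\<delta> / (2 * exp 1) > 0"
    using \<delta> by simp
  then obtain C where C: "C > 0" "\<And>z. cmod (h z) \<le> C * exp (\<delta> / (2 * exp 1) * cmod z)"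
    using minimal_exponential_type_bound[OF h] by metis
  have "cmod T \<le> 2 * C * exp \<delta> * B"
    if T: "(\<lambda>n. a n * h (of_nat (Suc n)) * z ^ n) sums T"
      and B: "\<And>s. cmod s = \<delta> \<Longrightarrow> cmod (\<Sum>n. a n * (z * exp s) ^ n) \<le> B" for z T B
  proof -
    \<comment> \<open>A radius that bounds |z exp s| for every s on the circle |s| = \<delta>, so
      the tail \<open>t N\<close> is uniform in s.\<close>
    define r where "r = (cmod z + 1) * exp \<delta>"
    define t where "t = (\<lambda>N. \<Sum>n. cmod (a (n + N)) * r ^ (n + N))"
    have r: "r > 0"
      by (simp add: r_def add_nonneg_pos)
    have t0: "t \<longlonglongrightarrow> 0"
      unfolding t_def by (intro suminf_exist_split2 abs r)
    have part: "cmod (\<Sum>n<N. a n * h (of_nat (Suc n)) * z ^ n) \<le> 2 * C * (exp \<delta> * (B + t N))" for N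
    proof -
      \<comment> \<open>The multiplier is evaluated at n + 1, not n. The exponential sum thus
        carries an additional factor exp s, the source of exp \<delta> in the constant.\<close>
      have "cmod (\<Sum>n<N. (a n * z ^ n) * exp (of_nat (Suc n) * s)) \<le> exp \<delta> * (B + t N)" if s: "cmod s = \<delta>" for s
      proof -
        let ?w = "z * exp s"
        have es: "cmod (exp s) \<le> exp \<delta>"
          using complex_Re_le_cmod[of s] s by simp
        have le: "cmod (a n * ?w ^ n) \<le> cmod (a n) * r ^ n" for n
        proof -
          have "cmod ?w \<le> r"
            unfolding r_def norm_mult using es by (intro mult_mono) auto
          then show ?thesis
            by (simp add: norm_mult norm_power power_mono mult_left_mono)
        qed
        have sumw: "summable (\<lambda>n. a n * ?w ^ n)"
          by (rule summable_comparison_test'[OF abs[OF r], of 0]) (rule le)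
        have "cmod (\<Sum>n. a (n + N) * ?w ^ (n + N)) \<le> t N"
          unfolding t_def using summable_ignore_initial_segment[OF abs[OF r], of N] le
          by (intro norm_suminf_le)
        moreover have "(\<Sum>n<N. a n * ?w ^ n) = (\<Sum>n. a n * ?w ^ n) - (\<Sum>n. a (n + N) * ?w ^ (n + N))"
          using suminf_split_initial_segment[OF sumw, of N] by simp
        ultimately have "cmod (\<Sum>n<N. a n * ?w ^ n) \<le> B + t N"
          using B[OF s] norm_triangle_ineq4[of "\<Sum>n. a n * ?w ^ n" "\<Sum>n. a (n + N) * ?w ^ (n + N)"] by simp
        then have "cmod (exp s) * cmod (\<Sum>n<N. a n * ?w ^ n) \<le> exp \<delta> * (B + t N)"
          using es by (intro mult_mono) auto
        moreover have "(\<Sum>n<N. (a n * z ^ n) * exp (of_nat (Suc n) * s)) = exp s * (\<Sum>n<N. a n * ?w ^ n)"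
          by (simp add: sum_distrib_left power_mult_distrib exp_add ring_distribs mult_ac flip: exp_of_nat_mult)
        ultimately show ?thesis
          by (simp add: norm_mult)
      qed
      then have "cmod (\<Sum>n<N. (a n * z ^ n) * h (of_nat (Suc n))) \<le> 2 * C * (exp \<delta> * (B + t N))"
        by (intro multiplier_polynomial_bound[OF hol \<delta> C]) auto
      then show ?thesis
        by (simp add: mult_ac)
    qed
    have "(\<lambda>N. cmod (\<Sum>n<N. a n * h (of_nat (Suc n)) * z ^ n)) \<longlonglongrightarrow> cmod T"
      using T unfolding sums_def by (rule tendsto_norm)
    moreover have "(\<lambda>N. 2 * C * (exp \<delta> * (B + t N))) \<longlonglongrightarrow> 2 * C * (exp \<delta> * (B + 0))"
      by (intro tendsto_intros t0)
    ultimately have "cmod T \<le> 2 * C * (exp \<delta> * (B + 0))"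
      using part by (intro LIMSEQ_le) auto
    then show ?thesis
      by (simp add: mult_ac)
  qed
  then show ?thesis
    using C(1) by (intro exI[of _ "2 * C * exp \<delta>"]) auto
qed

section \<open>Propagation of near-maxima\<close>

lemma powers_dense_in_circle:
  assumes \<alpha>: "\<alpha> \<notin> \<rat>" and u: "cmod u = 1" and d: "d > 0"
  obtains j :: nat where "cmod (u - cis (4 * pi * \<alpha>) ^ j) < d"
proof -
  have irr: "2 * \<alpha> \<notin> \<rat>"
  proof
    assume "2 * \<alpha> \<in> \<rat>"
    then have "2 * \<alpha> / 2 \<in> \<rat>"
      by (intro Rats_divide) auto
    with \<alpha> show False
      by simp
  qed
  have dpos: "d / (2 * pi) > 0"
    using d by simp
  \<comment> \<open>Kronecker's approximation for 2 \<alpha>, since 4 \<pi> \<alpha> = 2 \<pi> (2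
    \<alpha>). Positivity of k matters: the functional equation is iterated only forwards.\<close>
  obtain h k :: int where k: "k > 0" and hk: "\<bar>of_int k * (2 * \<alpha>) - of_int h - Arg u / (2 * pi)\<bar> < d / (2 * pi)"
    using sequence_of_fractional_parts_is_dense[OF irr dpos] by blast
  have u': "u = cis (Arg u)"
    using cis_Arg[of u] u by (metis div_by_1 norm_zero of_real_1 sgn_eq zero_neq_one)
  have "cis (4 * pi * \<alpha>) ^ nat k = cis (of_int k * (4 * pi * \<alpha>))"
    using k by (simp add: Complex.DeMoivre)
  also have "\<dots> = cis (of_int k * (4 * pi * \<alpha>) - 2 * pi * of_int h)"
    by (simp add: cis_divide[symmetric])
  finally have "cmod (u - cis (4 * pi * \<alpha>) ^ nat k)
      = cmod (cis (of_int k * (4 * pi * \<alpha>) - 2 * pi * of_int h) - cis (Arg u))"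
    by (metis u' norm_minus_commute)
  also have "\<dots> \<le> \<bar>of_int k * (4 * pi * \<alpha>) - 2 * pi * of_int h - Arg u\<bar>"
    by (rule norm_cis_diff_le)
  also have "of_int k * (4 * pi * \<alpha>) - 2 * pi * of_int h - Arg u
      = 2 * pi * (of_int k * (2 * \<alpha>) - of_int h - Arg u / (2 * pi))"
    by (simp add: field_simps)
  also have "\<bar>\<dots>\<bar> < d"
    using mult_strict_left_mono[OF hk, of "2 * pi"] by (simp add: abs_mult)
  finally show ?thesis
    by (rule that)
qed

text \<open>Finitely many exponents are wanted because each brings its own threshold for r and its
  own admissible loss in the propagation.\<close>

lemma powers_uniformly_dense_in_circle:
  assumes \<alpha>: "\<alpha> \<notin> \<rat>" and d: "d > 0"
  obtains J :: "nat set" where "finite J"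
    "\<And>u. cmod u = 1 \<Longrightarrow> \<exists>j\<in>J. cmod (u - cis (4 * pi * \<alpha>) ^ j) < d"
proof -
  let ?B = "\<lambda>j::nat. ball (cis (4 * pi * \<alpha>) ^ j) d"
  have "sphere 0 1 \<subseteq> (\<Union>j\<in>UNIV. ?B j)"
  proof
    fix u :: complex assume "u \<in> sphere 0 1"
    then have "cmod u = 1"
      by simp
    from powers_dense_in_circle[OF \<alpha> this d] obtain j :: nat where "cmod (u - cis (4 * pi * \<alpha>) ^ j) < d"
      by blast
    then show "u \<in> (\<Union>j\<in>UNIV. ?B j)"
      by (auto simp: dist_norm norm_minus_commute)
  qed
  moreover have "compact (sphere (0::complex) 1)"
    by simp
  ultimately obtain J where "finite J" "sphere 0 1 \<subseteq> (\<Union>j\<in>J. ?B j)"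
    by (metis compactE_image open_ball)
  then show ?thesis
    by (intro that[of J]) (auto simp: dist_norm norm_minus_commute subset_iff)
qed

lemma exp_near_zero:
  assumes "d > 0"
  obtains \<delta> :: real where "\<delta> > 0" "\<And>S::complex. cmod S \<le> \<delta> \<Longrightarrow> cmod (exp S - 1) < d"
proof -
  have "isCont (exp :: complex \<Rightarrow> complex) 0"
    by (intro continuous_intros)
  then obtain e where e: "e > 0" "\<And>S::complex. dist S 0 < e \<Longrightarrow> dist (exp S) (exp 0) < d"
    using assms unfolding continuous_at_eps_delta by blast
  then show ?thesis
    by (intro that[of "e / 2"]) (auto simp: dist_norm)
qed

text \<open>The budget is fixed backwards: to lose at most \<epsilon> after j + 1 steps, spend
  \<epsilon> / 2 and half of the displacement \<delta> on the first j. One step costs a factor of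
  order r, negligible against exp (\<epsilon> r^\<rho> / 2). Displacements are measured in ln z,
  where they add up.\<close>

lemma near_maximum_propagates:
  fixes f :: "complex \<Rightarrow> complex"
  assumes p: "cmod p = 1" and \<rho>: "\<rho> > 0"
    and step: "\<And>\<delta>. \<delta> > 0 \<Longrightarrow> \<exists>C>0. \<forall>z B. (\<forall>s. cmod s = \<delta> \<longrightarrow> cmod (f (p * z * exp s)) \<le> B) \<longrightarrow>
                 cmod (f z - f 0) \<le> C * cmod z * B"
    and \<epsilon>: "0 < \<epsilon>" "\<epsilon> < \<sigma>" and \<delta>: "\<delta> > 0"
  shows "\<exists>\<epsilon>'>0. \<epsilon>' \<le> \<epsilon> \<and> (\<forall>\<^sub>F r in at_top. \<forall>z. cmod z = r \<longrightarrow> exp ((\<sigma> - \<epsilon>') * r powr \<rho>) \<le> cmod (f z) \<longrightarrow>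
           (\<exists>S. cmod S \<le> \<delta> \<and> exp ((\<sigma> - \<epsilon>) * r powr \<rho>) \<le> cmod (f (p ^ j * z * exp S))))"
  using \<epsilon> \<delta>
proof (induction j arbitrary: \<epsilon> \<delta>)
  case 0
  then have "\<forall>\<^sub>F r in at_top. \<forall>z. cmod z = r \<longrightarrow> exp ((\<sigma> - \<epsilon>) * r powr \<rho>) \<le> cmod (f z) \<longrightarrow>
           (\<exists>S. cmod S \<le> \<delta> \<and> exp ((\<sigma> - \<epsilon>) * r powr \<rho>) \<le> cmod (f (p ^ 0 * z * exp S)))"
    by (intro always_eventually allI impI exI[of _ 0]) auto
  with 0 show ?case
    by blast
next
  case (Suc j)
  have half: "0 < \<epsilon> / 2" "\<epsilon> / 2 < \<sigma>" "\<delta> / 2 > 0"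
    using Suc.prems by auto
  obtain \<epsilon>' where \<epsilon>': "\<epsilon>' > 0" "\<epsilon>' \<le> \<epsilon> / 2" and
    IH: "\<forall>\<^sub>F r in at_top. \<forall>z. cmod z = r \<longrightarrow> exp ((\<sigma> - \<epsilon>') * r powr \<rho>) \<le> cmod (f z) \<longrightarrow>
           (\<exists>S. cmod S \<le> \<delta> / 2 \<and> exp ((\<sigma> - \<epsilon> / 2) * r powr \<rho>) \<le> cmod (f (p ^ j * z * exp S)))"
    using Suc.IH[OF half] by blast
  obtain C where C: "C > 0" and
    C_step: "\<And>z B. (\<And>s. cmod s = \<delta> / 2 \<Longrightarrow> cmod (f (p * z * exp s)) \<le> B) \<Longrightarrow>
                 cmod (f z - f 0) \<le> C * cmod z * B"
    using step[OF half(3)] by blast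
  define c where "c = cmod (f 0)"
  have "c \<ge> 0"
    by (simp add: c_def)
  have "\<forall>\<^sub>F r in at_top. c + C * exp \<delta> * r < exp (\<epsilon> / 2 * r powr \<rho>)"
    using C \<rho> Suc.prems(1) by real_asymp
  with IH have "\<forall>\<^sub>F r in at_top. \<forall>z. cmod z = r \<longrightarrow> exp ((\<sigma> - \<epsilon>') * r powr \<rho>) \<le> cmod (f z) \<longrightarrow>
           (\<exists>S. cmod S \<le> \<delta> \<and> exp ((\<sigma> - \<epsilon>) * r powr \<rho>) \<le> cmod (f (p ^ Suc j * z * exp S)))"
    using eventually_gt_at_top[of 0]
  proof eventually_elim
    case (elim r)
    show ?case
    proof (intro allI impI)
      fix z assume z: "cmod z = r" "exp ((\<sigma> - \<epsilon>') * r powr \<rho>) \<le> cmod (f z)"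
      with elim obtain S where S: "cmod S \<le> \<delta> / 2" "exp ((\<sigma> - \<epsilon> / 2) * r powr \<rho>) \<le> cmod (f (p ^ j * z * exp S))"
        by blast
      define y where "y = p ^ j * z * exp S"
      define B where "B = exp ((\<sigma> - \<epsilon>) * r powr \<rho>)"
      \<comment> \<open>This is where \<epsilon> < \<sigma> enters; it lets the constant |f 0| be
        absorbed into a multiple of B.\<close>
      have "B \<ge> 1"
        using Suc.prems by (simp add: B_def)
      have "Re S \<le> \<delta>"
        using complex_Re_le_cmod[of S] S Suc.prems by linarith
      then have ny: "cmod y \<le> r * exp \<delta>"
        using z p elim by (simp add: y_def norm_mult norm_power)
      \<comment> \<open>If |f| stayed below B on the whole curve around \<open>p * y\<close>, the
        functional equation would make |f y| smaller than it is known to be.\<close>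
      have "\<exists>s. cmod s = \<delta> / 2 \<and> B \<le> cmod (f (p * y * exp s))"
      proof (rule ccontr)
        assume "\<not> ?thesis"
        then have "cmod (f y - f 0) \<le> C * cmod y * B"
          by (intro C_step) (auto simp: not_le less_imp_le)
        then have "cmod (f y) \<le> c + C * cmod y * B"
          using norm_triangle_ineq2[of "f y" "f 0"] by (simp add: c_def)
        also have "\<dots> \<le> c * B + C * (r * exp \<delta>) * B"
          using ny C \<open>B \<ge> 1\<close> mult_left_mono[OF \<open>B \<ge> 1\<close> \<open>c \<ge> 0\<close>]
          by (intro add_mono mult_right_mono mult_left_mono) auto
        also have "\<dots> = (c + C * exp \<delta> * r) * B"
          by (simp add: algebra_simps)
        also have "\<dots> < exp (\<epsilon> / 2 * r powr \<rho>) * B"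
          using elim \<open>B \<ge> 1\<close> by (intro mult_strict_right_mono) auto
        also have "\<dots> = exp ((\<sigma> - \<epsilon> / 2) * r powr \<rho>)"
          by (simp add: B_def algebra_simps flip: exp_add)
        finally show False
          using S by (simp add: y_def)
      qed
      then obtain s where s: "cmod s = \<delta> / 2" "B \<le> cmod (f (p * y * exp s))"
        by blast
      have "cmod (S + s) \<le> \<delta>"
        using norm_triangle_ineq[of S s] S s by linarith
      moreover have "p * y * exp s = p ^ Suc j * z * exp (S + s)"
        by (simp add: y_def exp_add mult_ac)
      ultimately show "\<exists>S. cmod S \<le> \<delta> \<and> exp ((\<sigma> - \<epsilon>) * r powr \<rho>) \<le> cmod (f (p ^ Suc j * z * exp S))"
        using s unfolding B_def by metis
    qed
  qed
  then show ?case
    using \<epsilon>' Suc.prems by (intro exI[of _ \<epsilon>']) auto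
qed

text \<open>Start from a near-maximum z0 on the circle of radius t |w|, choose j so that p^j turns
  z0 close to the direction of w, and propagate j times.\<close>

lemma near_maximum_dense:
  fixes f :: "complex \<Rightarrow> complex"
  assumes f0: "f 0 \<noteq> 0" and \<alpha>: "\<alpha> \<notin> \<rat>" and \<rho>: "\<rho> > 0" and \<sigma>: "\<sigma> > 0"
    and lower: "\<And>\<epsilon>. \<epsilon> > 0 \<Longrightarrow> \<forall>\<^sub>F r in at_top. \<exists>z. cmod z = r \<and> exp ((\<sigma> - \<epsilon>) * r powr \<rho>) \<le> cmod (f z)"
    and step: "\<And>\<delta>. \<delta> > 0 \<Longrightarrow> \<exists>C>0. \<forall>z B. (\<forall>s. cmod s = \<delta> \<longrightarrow> cmod (f (cis (4 * pi * \<alpha>) * z * exp s)) \<le> B) \<longrightarrow>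
                 cmod (f z - f 0) \<le> C * cmod z * B"
    and \<eta>: "\<eta> > 0" and \<epsilon>: "\<epsilon> > 0"
  shows "\<forall>\<^sub>F t in at_top. \<exists>z\<in>cball w \<eta>. exp (t powr \<rho> * (\<sigma> * cmod z powr \<rho> - \<epsilon>)) \<le> cmod (f (of_real t * z))"
proof (cases "w = 0")
  case True
  \<comment> \<open>Since \<open>0 powr \<rho> = 0\<close>, the witness z = 0 works as soon as exp
    (- \<epsilon> t^\<rho>) is below |f 0|.\<close>
  have "\<forall>\<^sub>F t in at_top. exp (- (t powr \<rho> * \<epsilon>)) < cmod (f 0)"
    using f0 by (intro order_tendstoD(2)[of _ 0]) (use \<rho> \<epsilon> in \<open>real_asymp, simp\<close>)
  then show ?thesis
    by eventually_elim (use True \<eta> in \<open>auto intro!: bexI[of _ 0]\<close>)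
next
  case False
  define p where "p = cis (4 * pi * \<alpha>)"
  define W where "W = cmod w"
  have W: "W > 0"
    using False by (simp add: W_def)
  \<comment> \<open>The rotation error and the factor exp S contribute at most t W d each, together
    t \<eta>.\<close>
  define d where "d = \<eta> / (2 * W)"
  have d: "d > 0"
    using \<eta> W by (simp add: d_def)
  obtain J where J: "finite J" "\<And>u. cmod u = 1 \<Longrightarrow> \<exists>j\<in>J. cmod (u - p ^ j) < d"
    unfolding p_def using powers_uniformly_dense_in_circle[OF \<alpha> d] by metis
  obtain \<delta>1 where \<delta>1: "\<delta>1 > 0" "\<And>S::complex. cmod S \<le> \<delta>1 \<Longrightarrow> cmod (exp S - 1) < d"
    using exp_near_zero[OF d] by metis
  \<comment> \<open>The target involves |z|, which may exceed W by a factor exp \<delta>; half of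
    \<epsilon> is reserved for this.\<close>
  have "((\<lambda>x. \<sigma> * (W * exp x) powr \<rho>) \<longlongrightarrow> \<sigma> * (W * exp 0) powr \<rho>) (at_right 0)"
    using W by (intro tendsto_intros) auto
  then have "\<forall>\<^sub>F x in at_right 0. \<sigma> * (W * exp x) powr \<rho> < \<sigma> * W powr \<rho> + \<epsilon> / 2"
    using \<epsilon> by (intro order_tendstoD(2)[of _ "\<sigma> * W powr \<rho>"]) auto
  then have "\<forall>\<^sub>F x in at_right 0. \<sigma> * (W * exp x) powr \<rho> < \<sigma> * W powr \<rho> + \<epsilon> / 2 \<and> 0 < x \<and> x < \<delta>1"
    using eventually_at_right_real[OF \<delta>1(1)] by eventually_elim auto
  then obtain \<delta> where \<delta>: "\<sigma> * (W * exp \<delta>) powr \<rho> < \<sigma> * W powr \<rho> + \<epsilon> / 2" "0 < \<delta>" "\<delta> < \<delta>1"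
    using eventually_happens'[OF trivial_limit_at_right_real] by blast
  \<comment> \<open>The loss in propagation takes the other half of \<epsilon> after scaling by
    W^\<rho>; the bound \<sigma> / 2 guarantees e < \<sigma>.\<close>
  define e where "e = min (\<sigma> / 2) (\<epsilon> / (2 * W powr \<rho>))"
  have e: "0 < e" "e < \<sigma>" "e * W powr \<rho> \<le> \<epsilon> / 2"
  proof -
    show "0 < e" "e < \<sigma>"
      using \<sigma> \<epsilon> W by (auto simp: e_def)
    have "e * W powr \<rho> \<le> \<epsilon> / (2 * W powr \<rho>) * W powr \<rho>"
      by (intro mult_right_mono) (auto simp: e_def)
    then show "e * W powr \<rho> \<le> \<epsilon> / 2"
      using W by simp
  qed
  have p1: "cmod p = 1"
    by (simp add: p_def)
  define Q where "Q = (\<lambda>j \<epsilon>' r. \<forall>z. cmod z = r \<longrightarrow> exp ((\<sigma> - \<epsilon>') * r powr \<rho>) \<le> cmod (f z) \<longrightarrow>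
           (\<exists>S. cmod S \<le> \<delta> \<and> exp ((\<sigma> - e) * r powr \<rho>) \<le> cmod (f (p ^ j * z * exp S))))"
  have "\<exists>\<epsilon>'>0. \<epsilon>' \<le> e \<and> (\<forall>\<^sub>F r in at_top. Q j \<epsilon>' r)" for j
    unfolding Q_def by (rule near_maximum_propagates[OF p1 \<rho> step[folded p_def] e(1,2) \<delta>(2)])
  then obtain E where E: "\<And>j. E j > 0" "\<And>j. \<forall>\<^sub>F r in at_top. Q j (E j) r"
    by metis
  \<comment> \<open>The exponent j depends on z0, which is chosen first, so z0 must be good enough
    for every j in J. Inserting 1 guards \<open>Min\<close> against an empty set.\<close>
  define E0 where "E0 = Min (insert 1 (E ` J))"
  have E0: "E0 > 0" "\<And>j. j \<in> J \<Longrightarrow> E0 \<le> E j"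
    using J(1) E(1) by (auto simp: E0_def)
  have "\<forall>\<^sub>F r in at_top. \<forall>j\<in>J. Q j (E j) r"
    using J(1) E(2) by (intro eventually_ball_finite) auto
  then have "\<forall>\<^sub>F r in at_top. r > 0 \<and> (\<exists>z. cmod z = r \<and> exp ((\<sigma> - E0) * r powr \<rho>) \<le> cmod (f z)) \<and>
      (\<forall>j\<in>J. Q j (E j) r)"
    using lower[OF E0(1)] eventually_gt_at_top[of 0] by eventually_elim blast
  moreover have "filterlim (\<lambda>t. t * W) at_top at_top"
    using W by real_asymp
  ultimately have "\<forall>\<^sub>F t in at_top. t * W > 0 \<and>
      (\<exists>z. cmod z = t * W \<and> exp ((\<sigma> - E0) * (t * W) powr \<rho>) \<le> cmod (f z)) \<and> (\<forall>j\<in>J. Q j (E j) (t * W))"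
    by (rule eventually_compose_filterlim)
  then show ?thesis
  proof eventually_elim
    case (elim t)
    then have t: "t > 0"
      using W by (simp add: zero_less_mult_iff)
    from elim obtain z0 where z0: "cmod z0 = t * W" "exp ((\<sigma> - E0) * (t * W) powr \<rho>) \<le> cmod (f z0)"
      by blast
    have z0nz: "z0 \<noteq> 0"
      using z0 t W by auto
    have "cmod (of_real t * w / z0) = 1"
      using z0 t W by (simp add: norm_divide norm_mult W_def)
    then obtain j where j: "j \<in> J" "cmod (of_real t * w / z0 - p ^ j) < d"
      using J(2) by blast
    have "exp ((\<sigma> - E j) * (t * W) powr \<rho>) \<le> exp ((\<sigma> - E0) * (t * W) powr \<rho>)"
      using E0(2)[OF j(1)] by (auto intro!: mult_right_mono)
    then have "exp ((\<sigma> - E j) * (t * W) powr \<rho>) \<le> cmod (f z0)"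
      using z0(2) by linarith
    moreover have "Q j (E j) (t * W)"
      using elim j(1) by blast
    ultimately obtain S where S: "cmod S \<le> \<delta>" "exp ((\<sigma> - e) * (t * W) powr \<rho>) \<le> cmod (f (p ^ j * z0 * exp S))"
      using z0(1) unfolding Q_def by blast
    define z where "z = p ^ j * z0 * exp S / of_real t"
    have tz: "of_real t * z = p ^ j * z0 * exp S"
      using t by (simp add: z_def)
    have "cmod (w - z) \<le> \<eta>"
    proof -
      have "of_real t * (w - z) = z0 * (of_real t * w / z0 - p ^ j) - p ^ j * z0 * (exp S - 1)"
        using z0nz tz by (simp add: algebra_simps)
      then have "t * cmod (w - z) \<le> cmod (z0 * (of_real t * w / z0 - p ^ j)) + cmod (p ^ j * z0 * (exp S - 1))"
        using t by (metis norm_mult norm_of_real abs_of_pos norm_triangle_ineq4)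
      also have "\<dots> \<le> t * W * d + t * W * d"
        using z0 p1 j(2) \<delta>1(2)[of S] S(1) \<delta>(3) t W
        by (intro add_mono) (auto simp: norm_mult norm_power intro!: mult_left_mono)
      also have "\<dots> = t * \<eta>"
        using W by (simp add: d_def)
      finally show ?thesis
        using t by simp
    qed
    moreover have "exp (t powr \<rho> * (\<sigma> * cmod z powr \<rho> - \<epsilon>)) \<le> cmod (f (of_real t * z))"
    proof -
      have "cmod z = W * exp (Re S)"
        using t z0 p1 by (simp add: z_def norm_mult norm_divide norm_power)
      also have "\<dots> \<le> W * exp \<delta>"
        using complex_Re_le_cmod[of S] S(1) W by simp
      finally have "\<sigma> * cmod z powr \<rho> \<le> \<sigma> * (W * exp \<delta>) powr \<rho>"
        using \<sigma> \<rho> by (intro mult_left_mono powr_mono2) auto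
      then have "\<sigma> * cmod z powr \<rho> - \<epsilon> \<le> (\<sigma> - e) * W powr \<rho>"
        using \<delta>(1) e(3) by (simp add: left_diff_distrib)
      then have "t powr \<rho> * (\<sigma> * cmod z powr \<rho> - \<epsilon>) \<le> t powr \<rho> * ((\<sigma> - e) * W powr \<rho>)"
        by (intro mult_left_mono) auto
      also have "\<dots> = (\<sigma> - e) * (t * W) powr \<rho>"
        using t W by (simp add: powr_mult)
      finally show ?thesis
        using S(2) unfolding tz by (meson exp_le_cancel_iff order_trans)
    qed
    ultimately show ?case
      by (intro bexI[of _ z]) (auto simp: dist_norm)
  qed
qed

section \<open>Coefficients and growth\<close>

text \<open>Over real n the left side is maximal where ln n = \<rho> x - 1, with value n / \<rho>.
  The proof is ln y <= y - 1 at the quotient of the maximiser by n. With x = ln r + c the right side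
  is \<sigma> r^\<rho>.\<close>

lemma entropy_bound:
  fixes x \<rho> :: real
  assumes \<rho>: "\<rho> > 0"
  shows "real n * x - real n * ln (real n) / \<rho> \<le> exp (\<rho> * x - 1) / \<rho>"
proof (cases "n = 0")
  case False
  define m where "m = exp (\<rho> * x - 1)"
  have "ln (m / n) \<le> m / n - 1"
    using False by (intro ln_le_minus_one) (simp add: m_def)
  then have "\<rho> * x - ln n \<le> m / n"
    using False by (simp add: m_def ln_div)
  then have "real n * (\<rho> * x - ln n) \<le> real n * (m / n)"
    by (intro mult_left_mono) auto
  then have "(\<rho> * (real n * x) - real n * ln n) / \<rho> \<le> m / \<rho>"
    using False \<rho> by (intro divide_right_mono) (auto simp: algebra_simps)
  then show ?thesis
    using \<rho> by (simp add: m_def diff_divide_distrib)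
qed (use \<rho> in auto)

lemma coefficient_asymptotics:
  fixes cs :: "nat \<Rightarrow> complex"
  assumes "(\<lambda>n. - ln (cmod (cs n)) - (1 / \<rho> * real n * ln (real n) - c * real n)) \<in> o(\<lambda>n. real n)"
    and "\<epsilon> > 0"
  shows "\<forall>\<^sub>F n in sequentially. \<bar>ln (cmod (cs n)) + real n * ln (real n) / \<rho> - c * real n\<bar> \<le> \<epsilon> * real n"
  using landau_o.smallD[OF assms] by eventually_elim (simp add: abs_le_iff algebra_simps)

text \<open>A zero factor annihilates all later coefficients; as \<open>ln 0 = 0\<close>, the
  asymptotics would then force n ln n / \<rho> - c n to be o(n).\<close>

lemma coefficients_nonzero:
  fixes cs :: "nat \<Rightarrow> complex" and h :: "nat \<Rightarrow> complex"
  assumes cs: "\<And>n. cs n = (\<Prod>k\<le>n. h k)" and \<rho>: "\<rho> > 0"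
    and asym: "(\<lambda>n. - ln (cmod (cs n)) - (1 / \<rho> * real n * ln (real n) - c * real n)) \<in> o(\<lambda>n. real n)"
  shows "cs n \<noteq> 0"
proof
  assume "cs n = 0"
  then obtain k where k: "k \<le> n" "h k = 0"
    by (auto simp: cs)
  have "\<forall>\<^sub>F m in sequentially. real m * ln (real m) / \<rho> - c * real m > 1 * real m"
    using \<rho> by real_asymp
  with coefficient_asymptotics[OF asym zero_less_one] eventually_ge_at_top[of n]
  have "\<forall>\<^sub>F m in sequentially. False"
  proof eventually_elim
    case (elim m)
    have "cs m = 0"
      unfolding cs using elim k by (intro prod_zero) auto
    then show ?case
      using elim by simp
  qed
  then show False
    by simp
qed

text \<open>The geometric factor makes the bound summable in n while its main part stays close to
  exp (\<sigma> r^\<rho>).\<close>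

lemma coefficient_upper_bound:
  fixes cs :: "nat \<Rightarrow> complex"
  assumes nz: "\<And>n. cs n \<noteq> 0" and \<rho>: "\<rho> > 0" and \<epsilon>: "\<epsilon> > 0"
    and asym: "(\<lambda>n. - ln (cmod (cs n)) - (1 / \<rho> * real n * ln (real n) - c * real n)) \<in> o(\<lambda>n. real n)"
  obtains C where "C > 0"
    "\<And>r n. r > 0 \<Longrightarrow> cmod (cs n) * r ^ n \<le> C * exp (exp (\<rho> * c - 1) / \<rho> * exp (2 * \<rho> * \<epsilon>) * r powr \<rho>) * exp (- \<epsilon>) ^ n"
proof -
  define b where "b = (\<lambda>n. exp ((c + \<epsilon>) * real n - real n * ln (real n) / \<rho>))"
  obtain n0 where n0: "\<And>n. n \<ge> n0 \<Longrightarrow> \<bar>ln (cmod (cs n)) + real n * ln (real n) / \<rho> - c * real n\<bar> \<le> \<epsilon> * real n"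
    using coefficient_asymptotics[OF asym \<epsilon>] unfolding eventually_sequentially by blast
  \<comment> \<open>The sum absorbs the finitely many indices before the asymptotics take
    hold.\<close>
  define C where "C = 1 + (\<Sum>n<n0. cmod (cs n) / b n)"
  have C: "C > 0"
    unfolding C_def by (intro add_pos_nonneg sum_nonneg) (auto simp: b_def)
  have cb: "cmod (cs n) \<le> C * b n" for n
  proof (cases "n < n0")
    case True
    have "cmod (cs n) / b n \<le> (\<Sum>n<n0. cmod (cs n) / b n)"
      using True by (intro member_le_sum) (auto simp: b_def)
    then have "cmod (cs n) / b n \<le> C"
      by (simp add: C_def)
    then show ?thesis
      by (simp add: b_def divide_le_eq)
  next
    case False
    then have "ln (cmod (cs n)) \<le> (c + \<epsilon>) * real n - real n * ln (real n) / \<rho>"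
      using n0[of n] by (simp add: algebra_simps abs_le_iff)
    then have "exp (ln (cmod (cs n))) \<le> b n"
      unfolding b_def exp_le_cancel_iff .
    then have "cmod (cs n) \<le> 1 * b n"
      using nz[of n] by simp
    also have "\<dots> \<le> C * b n"
      unfolding C_def by (intro mult_right_mono) (auto intro!: sum_nonneg simp: b_def)
    finally show ?thesis .
  qed
  have "cmod (cs n) * r ^ n \<le> C * exp (exp (\<rho> * c - 1) / \<rho> * exp (2 * \<rho> * \<epsilon>) * r powr \<rho>) * exp (- \<epsilon>) ^ n"
    if r: "r > 0" for r n
  proof -
    \<comment> \<open>One \<epsilon> pays for the error in the asymptotics, the other is split off
      as the factor exp (- \<epsilon>) ^ n.\<close>
    define x where "x = ln r + c + 2 * \<epsilon>"
    have rn: "r ^ n = exp (real n * ln r)"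
      using r by (simp add: exp_of_nat_mult)
    have "exp (\<rho> * x - 1) = exp (\<rho> * c - 1) * exp (2 * \<rho> * \<epsilon>) * r powr \<rho>"
      using r by (simp add: x_def powr_def algebra_simps flip: exp_add)
    then have "exp (real n * x - real n * ln (real n) / \<rho>)
        \<le> exp (exp (\<rho> * c - 1) / \<rho> * exp (2 * \<rho> * \<epsilon>) * r powr \<rho>)"
      using entropy_bound[OF \<rho>, of n x] by simp
    then have "C * exp (real n * x - real n * ln (real n) / \<rho>) * exp (- \<epsilon>) ^ n
        \<le> C * exp (exp (\<rho> * c - 1) / \<rho> * exp (2 * \<rho> * \<epsilon>) * r powr \<rho>) * exp (- \<epsilon>) ^ n"
      using C by (intro mult_right_mono mult_left_mono) auto
    moreover have "b n * r ^ n = exp (real n * x - real n * ln (real n) / \<rho>) * exp (- \<epsilon>) ^ n"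
      unfolding rn by (simp add: b_def x_def algebra_simps flip: exp_of_nat_mult exp_add)
    moreover have "cmod (cs n) * r ^ n \<le> C * b n * r ^ n"
      using cb r by (intro mult_right_mono) auto
    ultimately show ?thesis
      by (simp add: mult.assoc)
  qed
  then show ?thesis
    using C that by blast
qed

lemma power_series_entire:
  fixes a :: "nat \<Rightarrow> complex"
  assumes abs: "\<And>r. r > 0 \<Longrightarrow> summable (\<lambda>n. cmod (a n) * r ^ n)"
  shows "(\<lambda>n. a n * z ^ n) sums (\<Sum>n. a n * z ^ n)"
    and "(\<lambda>z. \<Sum>n. a n * z ^ n) holomorphic_on UNIV"
    and "a n = (deriv ^^ n) (\<lambda>z. \<Sum>n. a n * z ^ n) 0 / fact n"
proof -
  have sm: "summable (\<lambda>n. a n * z ^ n)" for z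
  proof (rule summable_comparison_test')
    show "summable (\<lambda>n. cmod (a n) * (cmod z + 1) ^ n)"
      by (intro abs) (simp add: add_nonneg_pos)
    show "cmod (a n * z ^ n) \<le> cmod (a n) * (cmod z + 1) ^ n" for n
      by (auto simp: norm_mult norm_power intro!: mult_left_mono power_mono)
  qed
  then show "(\<lambda>n. a n * z ^ n) sums (\<Sum>n. a n * z ^ n)"
    by (rule summable_sums)
  have "conv_radius a = \<infinity>"
    using sm by (rule conv_radius_inftyI'')
  then have rad: "fps_conv_radius (Abs_fps a) = \<infinity>"
    by (simp add: fps_conv_radius_def)
  have eval: "eval_fps (Abs_fps a) = (\<lambda>z. \<Sum>n. a n * z ^ n)"
    by (simp add: eval_fps_def fun_eq_iff)
  show "(\<lambda>z. \<Sum>n. a n * z ^ n) holomorphic_on UNIV"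
    unfolding eval[symmetric] by (rule holomorphic_on_eval_fps) (simp add: rad)
  show "a n = (deriv ^^ n) (\<lambda>z. \<Sum>n. a n * z ^ n) 0 / fact n"
    using fps_nth_conv_deriv[of "Abs_fps a" n] by (simp add: rad eval)
qed

lemma max_modulus_coefficient_bound:
  fixes f :: "complex \<Rightarrow> complex"
  assumes f: "f holomorphic_on UNIV" and r: "r > 0"
  obtains z where "cmod z = r" "\<And>n. cmod ((deriv ^^ n) f 0 / fact n) * r ^ n \<le> cmod (f z)"
proof -
  have cont: "continuous_on A f" for A
    using holomorphic_on_imp_continuous_on[OF f] by (rule continuous_on_subset) simp
  have "sphere (0::complex) r \<noteq> {}"
    using r by auto
  then obtain z where z: "z \<in> sphere 0 r" and max: "\<And>y. y \<in> sphere 0 r \<Longrightarrow> cmod (f y) \<le> cmod (f z)"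
    using continuous_attains_sup[of "sphere 0 r" "\<lambda>w. cmod (f w)"] continuous_on_norm[OF cont] by auto
  have "cmod ((deriv ^^ n) f 0 / fact n) * r ^ n \<le> cmod (f z)" for n
  proof -
    have "cmod ((deriv ^^ n) f 0) \<le> fact n * cmod (f z) / r ^ n"
      using r max by (intro Cauchy_inequality holomorphic_on_subset[OF f] cont) auto
    then show ?thesis
      using r by (simp add: norm_divide field_simps)
  qed
  then show ?thesis
    using z by (intro that[of z]) auto
qed

text \<open>A single term suffices: its index is the integer part of the maximiser m = \<rho>
  \<sigma> r^\<rho> from the entropy bound.\<close>

lemma coefficient_lower_bound:
  fixes cs :: "nat \<Rightarrow> complex"
  assumes nz: "\<And>n. cs n \<noteq> 0" and \<rho>: "\<rho> > 0" and \<epsilon>: "\<epsilon> > 0"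
    and asym: "(\<lambda>n. - ln (cmod (cs n)) - (1 / \<rho> * real n * ln (real n) - c * real n)) \<in> o(\<lambda>n. real n)"
  shows "\<forall>\<^sub>F r in at_top. \<exists>n. exp ((exp (\<rho> * c - 1) / \<rho> - \<epsilon>) * r powr \<rho>) \<le> cmod (cs n) * r ^ n"
proof -
  define \<sigma> where "\<sigma> = exp (\<rho> * c - 1) / \<rho>"
  have \<sigma>: "\<sigma> > 0"
    using \<rho> by (simp add: \<sigma>_def)
  \<comment> \<open>The first entry keeps 1 / \<rho> - e positive, so n may be replaced by m - 1;
    the second limits the loss e \<rho> \<sigma> to \<epsilon> / 2.\<close>
  define e where "e = min (1 / (2 * \<rho>)) (\<epsilon> / (2 * \<rho> * \<sigma>))"
  have e: "e > 0" "e < 1 / \<rho>" "e * (\<rho> * \<sigma>) \<le> \<epsilon> / 2"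
  proof -
    show "e > 0"
      using \<rho> \<sigma> \<epsilon> by (simp add: e_def)
    have "e \<le> 1 / (2 * \<rho>)"
      by (simp add: e_def)
    also have "\<dots> < 1 / \<rho>"
      using \<rho> by (simp add: field_simps)
    finally show "e < 1 / \<rho>" .
    have "e * (\<rho> * \<sigma>) \<le> \<epsilon> / (2 * \<rho> * \<sigma>) * (\<rho> * \<sigma>)"
      using \<rho> \<sigma> by (intro mult_right_mono) (auto simp: e_def)
    then show "e * (\<rho> * \<sigma>) \<le> \<epsilon> / 2"
      using \<rho> \<sigma> by (simp add: field_simps)
  qed
  obtain n0 where n0: "\<And>n. n \<ge> n0 \<Longrightarrow> \<bar>ln (cmod (cs n)) + real n * ln (real n) / \<rho> - c * real n\<bar> \<le> e * real n"
    using coefficient_asymptotics[OF asym e(1)] unfolding eventually_sequentially by blast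
  have "filterlim (\<lambda>r. \<rho> * \<sigma> * r powr \<rho>) at_top at_top"
    using \<rho> \<sigma> by real_asymp
  then have "\<forall>\<^sub>F r in at_top. real (n0 + 2) \<le> \<rho> * \<sigma> * r powr \<rho>"
    unfolding filterlim_at_top by blast
  moreover have "filterlim (\<lambda>r. \<epsilon> / 2 * r powr \<rho>) at_top at_top"
    using \<rho> \<epsilon> by real_asymp
  then have "\<forall>\<^sub>F r in at_top. 1 / \<rho> - e \<le> \<epsilon> / 2 * r powr \<rho>"
    unfolding filterlim_at_top by blast
  ultimately show ?thesis
    using eventually_gt_at_top[of 0]
  proof eventually_elim
    case (elim r)
    define m where "m = \<rho> * \<sigma> * r powr \<rho>"
    define n where "n = nat \<lfloor>m\<rfloor>"
    \<comment> \<open>The summand 2 leaves room for rounding: n >= m - 1 >= n0 + 1.\<close>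
    have m: "m \<ge> real (n0 + 2)"
      using elim by (simp add: m_def)
    then have nm: "real n \<le> m" "m - 1 \<le> real n"
      by (auto simp: n_def)
    then have n: "n \<ge> n0" "real n > 0"
      using m by linarith+
    have "ln (real n) \<le> ln m"
      using n nm by (intro ln_mono) auto
    also have "ln m = \<rho> * (ln r + c) - 1"
      using \<rho> elim by (simp add: m_def \<sigma>_def ln_mult ln_powr algebra_simps)
    finally have "real n * ln (real n) / \<rho> \<le> real n * (\<rho> * (ln r + c) - 1) / \<rho>"
      using \<rho> by (intro divide_right_mono mult_left_mono) auto
    also have "\<dots> = real n * (ln r + c) - real n / \<rho>"
      using \<rho> by (simp add: field_simps)
    finally have "real n * (1 / \<rho> - e) \<le> ln (cmod (cs n)) + real n * ln r"
      using n0[OF n(1)] by (simp add: algebra_simps abs_le_iff)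
    moreover have "(m - 1) * (1 / \<rho> - e) \<le> real n * (1 / \<rho> - e)"
      using nm e by (intro mult_right_mono) auto
    \<comment> \<open>Of the available \<epsilon> r^\<rho>, one half pays for the error e in the
      asymptotics and the other for rounding m down.\<close>
    moreover have "(\<sigma> - \<epsilon>) * r powr \<rho> \<le> (m - 1) * (1 / \<rho> - e)"
    proof -
      have "(e * (\<rho> * \<sigma>)) * r powr \<rho> \<le> \<epsilon> / 2 * r powr \<rho>"
        using e(3) by (intro mult_right_mono) auto
      moreover have "(m - 1) * (1 / \<rho> - e) = \<sigma> * r powr \<rho> - (e * (\<rho> * \<sigma>)) * r powr \<rho> - (1 / \<rho> - e)"
        using \<rho> by (simp add: m_def algebra_simps)
      moreover have "(\<sigma> - \<epsilon>) * r powr \<rho> = \<sigma> * r powr \<rho> - \<epsilon> / 2 * r powr \<rho> - \<epsilon> / 2 * r powr \<rho>"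
        by (simp add: left_diff_distrib)
      ultimately show ?thesis
        using elim(2) by linarith
    qed
    ultimately have "exp ((\<sigma> - \<epsilon>) * r powr \<rho>) \<le> exp (ln (cmod (cs n)) + real n * ln r)"
      by simp
    also have "\<dots> = cmod (cs n) * r ^ n"
      using nz[of n] elim by (simp add: exp_add exp_of_nat_mult)
    finally show ?case
      unfolding \<sigma>_def by blast
  qed
qed

lemma power_series_upper_bound:
  fixes a :: "nat \<Rightarrow> complex"
  assumes nz: "\<And>n. a n \<noteq> 0" and \<rho>: "\<rho> > 0"
    and asym: "(\<lambda>n. - ln (cmod (a n)) - (1 / \<rho> * real n * ln (real n) - c * real n)) \<in> o(\<lambda>n. real n)"
  shows "r > 0 \<Longrightarrow> summable (\<lambda>n. cmod (a n) * r ^ n)"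
    and "\<epsilon> > 0 \<Longrightarrow> \<forall>\<^sub>F r in at_top. \<forall>z. cmod z = r \<longrightarrow>
      cmod (\<Sum>n. a n * z ^ n) \<le> exp ((exp (\<rho> * c - 1) / \<rho> + \<epsilon>) * r powr \<rho>)"
proof -
  define \<sigma> where "\<sigma> = exp (\<rho> * c - 1) / \<rho>"
  have geo: "(\<lambda>n. K * exp (- \<delta>) ^ n) sums (K * (1 / (1 - exp (- \<delta>))))" if "\<delta> > 0" for K \<delta> :: real
    using that by (intro sums_mult geometric_sums) auto
  show abs: "summable (\<lambda>n. cmod (a n) * r ^ n)" if r: "r > 0" for r
  proof -
    obtain C where "\<And>r n. r > 0 \<Longrightarrow> cmod (a n) * r ^ n \<le> C * exp (\<sigma> * exp (2 * \<rho> * 1) * r powr \<rho>) * exp (- 1) ^ n"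
      using coefficient_upper_bound[OF nz \<rho> zero_less_one asym] unfolding \<sigma>_def by metis
    then show ?thesis
      using r by (intro summable_comparison_test'[OF sums_summable[OF geo[OF zero_less_one]], of 0]) auto
  qed
  show "\<forall>\<^sub>F r in at_top. \<forall>z. cmod z = r \<longrightarrow>
      cmod (\<Sum>n. a n * z ^ n) \<le> exp ((exp (\<rho> * c - 1) / \<rho> + \<epsilon>) * r powr \<rho>)" if \<epsilon>: "\<epsilon> > 0"
  proof -
    \<comment> \<open>Half of \<epsilon> covers the factor exp (2 \<rho> \<delta>) in the exponent;
      the other half later outgrows the constant K from the geometric series.\<close>
    have "((\<lambda>x. \<sigma> * exp (2 * \<rho> * x)) \<longlongrightarrow> \<sigma> * exp (2 * \<rho> * 0)) (at_right 0)"
      by (intro tendsto_intros)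
    then have "\<forall>\<^sub>F x in at_right 0. \<sigma> * exp (2 * \<rho> * x) < \<sigma> + \<epsilon> / 2"
      using \<epsilon> by (intro order_tendstoD(2)[of _ \<sigma>]) auto
    then have "\<forall>\<^sub>F x in at_right 0. \<sigma> * exp (2 * \<rho> * x) < \<sigma> + \<epsilon> / 2 \<and> 0 < x"
      using eventually_at_right_less[of 0] by eventually_elim auto
    then obtain \<delta> where \<delta>: "\<sigma> * exp (2 * \<rho> * \<delta>) < \<sigma> + \<epsilon> / 2" "0 < \<delta>"
      using eventually_happens'[OF trivial_limit_at_right_real] by blast
    obtain C where C: "C > 0"
      "\<And>r n. r > 0 \<Longrightarrow> cmod (a n) * r ^ n \<le> C * exp (\<sigma> * exp (2 * \<rho> * \<delta>) * r powr \<rho>) * exp (- \<delta>) ^ n"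
      using coefficient_upper_bound[OF nz \<rho> \<delta>(2) asym] unfolding \<sigma>_def by metis
    define K where "K = C * (1 / (1 - exp (- \<delta>)))"
    have "\<forall>\<^sub>F r in at_top. K \<le> exp (\<epsilon> / 2 * r powr \<rho>)"
      using \<epsilon> \<rho> by real_asymp
    then show ?thesis
      using eventually_gt_at_top[of 0]
    proof eventually_elim
      case (elim r)
      show ?case
      proof (intro allI impI)
        fix z assume z: "cmod z = r"
        let ?E = "exp (\<sigma> * exp (2 * \<rho> * \<delta>) * r powr \<rho>)"
        have "(\<lambda>n. a n * z ^ n) sums (\<Sum>n. a n * z ^ n)"
          using abs by (rule power_series_entire(1))
        moreover have "cmod (a n * z ^ n) \<le> C * ?E * exp (- \<delta>) ^ n" for n
          using C(2)[of r n] elim z by (simp add: norm_mult norm_power)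
        ultimately have "cmod (\<Sum>n. a n * z ^ n) \<le> C * ?E * (1 / (1 - exp (- \<delta>)))"
          using norm_sums_le[OF _ geo[OF \<delta>(2)]] by blast
        also have "\<dots> = K * ?E"
          by (simp add: K_def)
        also have "\<dots> \<le> exp (\<epsilon> / 2 * r powr \<rho>) * exp ((\<sigma> + \<epsilon> / 2) * r powr \<rho>)"
          using elim \<delta>(1) by (intro mult_mono) (auto intro!: mult_right_mono)
        also have "\<dots> = exp ((\<sigma> + \<epsilon>) * r powr \<rho>)"
          by (simp add: algebra_simps flip: exp_add)
        finally show "cmod (\<Sum>n. a n * z ^ n) \<le> exp ((exp (\<rho> * c - 1) / \<rho> + \<epsilon>) * r powr \<rho>)"
          by (simp add: \<sigma>_def)
      qed
    qed
  qed
qed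

section \<open>The functional equation of f and the conclusion\<close>

theorem theorem5:
  fixes \<rho> c \<alpha> :: real
    and h f :: "complex \<Rightarrow> complex"
    and cs :: "nat \<Rightarrow> complex"
  assumes "\<rho> > 0"
    and "\<alpha> \<notin> \<rat>"
    and "minimal_exponential_type h"
    and cs: "\<And>n. cs n = (\<Prod>k\<le>n. h (of_nat k))"
    and "(\<lambda>n. - ln (cmod (cs n)) - (1 / \<rho> * real n * ln (real n) - c * real n))
           \<in> o(\<lambda>n. real n)"
    and f: "\<And>z. f z = (\<Sum>n. cs n * exp (2 * of_real pi * \<i> * of_nat (n ^ 2) * of_real \<alpha>) * z ^ n)"
  shows "(\<forall>z. summable (\<lambda>n. cs n * exp (2 * of_real pi * \<i> * of_nat (n ^ 2) * of_real \<alpha>) * z ^ n))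
    \<and> f holomorphic_on UNIV
    \<and> entire_order f = ereal \<rho>
    \<and> normal_type \<rho> f
    \<and> completely_regular_growth \<rho> f
    \<and> (\<exists>H. \<forall>\<theta>. indicator_fun \<rho> f \<theta> = H)"
proof -
  note \<rho> = assms(1) and \<alpha> = assms(2) and h = assms(3) and asym = assms(5)
  define e where "e = (\<lambda>n. cis (2 * pi * (real n)\<^sup>2 * \<alpha>))"
  define a where "a = (\<lambda>n. cs n * e n)"
  have e_eq: "exp (2 * of_real pi * \<i> * of_nat (n ^ 2) * of_real \<alpha>) = e n" for n
    by (simp add: e_def cis_conv_exp mult_ac)
  have f_eq: "f = (\<lambda>z. \<Sum>n. a n * z ^ n)"
    unfolding a_def by (rule ext) (simp only: f e_eq)
  \<comment> \<open>The phases are unimodular, so the coefficient estimates behind order and type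
    depend only on \<open>cs\<close>.\<close>
  have norm_a: "cmod (a n) = cmod (cs n)" for n
    by (simp add: a_def e_def norm_mult)
  have cs_nz: "cs n \<noteq> 0" for n
    by (rule coefficients_nonzero[OF cs \<rho> asym])
  then have a_nz: "a n \<noteq> 0" for n
    using norm_a[of n] by (metis norm_eq_zero)
  have asym_a: "(\<lambda>n. - ln (cmod (a n)) - (1 / \<rho> * real n * ln (real n) - c * real n)) \<in> o(\<lambda>n. real n)"
    using asym by (simp add: norm_a)
  have abs: "summable (\<lambda>n. cmod (a n) * r ^ n)" if "r > 0" for r
    by (rule power_series_upper_bound(1)[OF a_nz \<rho> asym_a that])
  define \<sigma> where "\<sigma> = exp (\<rho> * c - 1) / \<rho>"
  have \<sigma>: "\<sigma> > 0"
    using \<rho> by (simp add: \<sigma>_def)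
  have hol: "f holomorphic_on UNIV"
    unfolding f_eq using abs by (rule power_series_entire(2))
  have f_sums: "(\<lambda>n. a n * z ^ n) sums f z" for z
    unfolding f_eq using abs by (rule power_series_entire(1))
  have f0: "f 0 = a 0"
    by (simp add: f_eq)
  have upper: "\<forall>\<^sub>F r in at_top. \<forall>z. cmod z = r \<longrightarrow> cmod (f z) \<le> exp ((\<sigma> + \<epsilon>) * r powr \<rho>)" if "\<epsilon> > 0" for \<epsilon>
    unfolding f_eq \<sigma>_def by (rule power_series_upper_bound(2)[OF a_nz \<rho> asym_a that])
  have lower: "\<forall>\<^sub>F r in at_top. \<exists>z. cmod z = r \<and> exp ((\<sigma> - \<epsilon>) * r powr \<rho>) \<le> cmod (f z)" if \<epsilon>: "\<epsilon> > 0" for \<epsilon>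
    using coefficient_lower_bound[OF a_nz \<rho> \<epsilon> asym_a] eventually_gt_at_top[of 0]
  proof eventually_elim
    case (elim r)
    obtain z where z: "cmod z = r" "\<And>n. cmod ((deriv ^^ n) f 0 / fact n) * r ^ n \<le> cmod (f z)"
      using max_modulus_coefficient_bound[OF hol elim(2)] by metis
    moreover have "(deriv ^^ n) f 0 / fact n = a n" for n
      unfolding f_eq using power_series_entire(3)[OF abs] by metis
    ultimately show ?case
      using elim(1) unfolding \<sigma>_def by (metis order_trans)
  qed
  define p where "p = cis (4 * pi * \<alpha>)"
  define q where "q = cis (2 * pi * \<alpha>)"
  have q: "q \<noteq> 0" "cmod q = 1"
    by (simp_all add: q_def)
  have rec: "a (Suc n) = q * (a n * h (of_nat (Suc n)) * p ^ n)" for n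
  proof -
    \<comment> \<open>In (n + 1)^2 = n^2 + 2n + 1 the summand 1 gives q, and 2n gives p^n with p =
      q^2.\<close>
    have "e (Suc n) = q * e n * p ^ n"
      by (simp add: e_def q_def p_def Complex.DeMoivre cis_mult) (simp add: algebra_simps power2_eq_square)
    then show ?thesis
      by (simp add: a_def cs mult_ac)
  qed
  have step: "\<exists>C>0. \<forall>z B. (\<forall>s. cmod s = \<delta> \<longrightarrow> cmod (f (p * z * exp s)) \<le> B) \<longrightarrow>
                 cmod (f z - f 0) \<le> C * cmod z * B" if \<delta>: "\<delta> > 0" for \<delta>
  proof -
    obtain C where C: "C > 0"
      "\<forall>z T B. (\<lambda>n. a n * h (of_nat (Suc n)) * z ^ n) sums T \<longrightarrow>
         (\<forall>s. cmod s = \<delta> \<longrightarrow> cmod (\<Sum>n. a n * (z * exp s) ^ n) \<le> B) \<longrightarrow> cmod T \<le> C * B"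
      using multiplier_local_bound[OF h \<delta> abs] by blast
    have "cmod (f z - f 0) \<le> C * cmod z * B"
      if B: "\<And>s. cmod s = \<delta> \<Longrightarrow> cmod (f (p * z * exp s)) \<le> B" for z B
    proof (cases "z = 0")
      case False
      have "(\<lambda>n. a (Suc n) * z ^ Suc n) sums (f z - f 0)"
        using f_sums[of z] by (subst sums_Suc_iff) (simp add: f0)
      \<comment> \<open>Dividing by \<open>q * z\<close> shifts the index and leaves the multiplier
        series at \<open>p * z\<close>; the divisor returns as |z| in the bound.\<close>
      then have "(\<lambda>n. a (Suc n) * z ^ Suc n / (q * z)) sums ((f z - f 0) / (q * z))"
        by (rule sums_divide)
      moreover have "a (Suc n) * z ^ Suc n / (q * z) = a n * h (of_nat (Suc n)) * (p * z) ^ n" for n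
        using False q by (simp add: rec power_mult_distrib)
      ultimately have "cmod ((f z - f 0) / (q * z)) \<le> C * B"
        using B by (intro C(2)[rule_format, of "p * z"]) (simp_all add: f_eq)
      then show ?thesis
        using False q by (simp add: norm_divide norm_mult divide_le_eq mult_ac)
    qed simp
    then show ?thesis
      using C(1) by blast
  qed
  have dense: "\<forall>\<^sub>F t in at_top. \<exists>z\<in>cball w \<eta>. exp (t powr \<rho> * (\<sigma> * cmod z powr \<rho> - \<epsilon>)) \<le> cmod (f (of_real t * z))"
    if "\<eta> > 0" "\<epsilon> > 0" for w \<eta> \<epsilon>
    using a_nz[of 0] that
    by (intro near_maximum_dense[OF _ \<alpha> \<rho> \<sigma> lower step[unfolded p_def]]) (auto simp: f0)
  have scaled: "\<forall>\<^sub>F t in at_top. \<forall>z\<in>cball 0 R. cmod (f (of_real t * z)) \<le> exp (t powr \<rho> * (\<sigma> * cmod z powr \<rho> + \<epsilon>))"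
    if "R > 0" "\<epsilon> > 0" for R \<epsilon>
    using \<sigma> by (intro upper_bound_scaled hol \<rho> upper that) auto
  have order: "entire_order f = ereal \<rho>" and type: "normal_type \<rho> f"
    by (rule order_and_type[OF \<rho> \<sigma> upper lower]; assumption)+
  have indicator: "indicator_fun \<rho> f \<theta> = ereal \<sigma>" for \<theta>
    by (rule indicator_eq[OF hol \<rho> \<sigma> upper scaled dense])
  have f_meas [measurable]: "f \<in> borel_measurable borel"
    using hol by (intro borel_measurable_continuous_onI holomorphic_on_imp_continuous_on)
  have "tends_to_distribution (\<lambda>t z. t powr (-\<rho>) * ln (cmod (f (of_real t * z))))
      (\<lambda>\<phi>. \<integral>z. of_real (\<sigma> * cmod z powr \<rho>) * \<phi> z \<partial>lborel)"
  proof (rule tends_to_distribution_of_L1)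
    show "continuous_on UNIV (\<lambda>z::complex. \<sigma> * cmod z powr \<rho>)"
      using \<rho> by (intro continuous_intros continuous_on_powr') auto
    show "(\<lambda>z. t powr (-\<rho>) * ln (cmod (f (of_real t * z)))) \<in> borel_measurable borel" for t
      by measurable
    show "\<forall>\<^sub>F t in at_top. (\<integral>\<^sup>+z\<in>ball 0 R. ennreal \<bar>t powr (-\<rho>) * ln (cmod (f (of_real t * z)))
            - \<sigma> * cmod z powr \<rho>\<bar> \<partial>lborel) \<le> ennreal \<epsilon>" if "R > 0" "\<epsilon> > 0" for R \<epsilon>
      by (rule L1_convergence[OF hol \<rho> less_imp_le[OF \<sigma>] upper dense that])
  qed
  then have "completely_regular_growth \<rho> f"
    unfolding completely_regular_growth_def using hol order type by blast
  moreover have "summable (\<lambda>n. cs n * exp (2 * of_real pi * \<i> * of_nat (n ^ 2) * of_real \<alpha>) * z ^ n)" for z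
    using sums_summable[OF f_sums[of z]] by (simp only: e_eq a_def)
  ultimately show ?thesis
    using hol order type indicator by blast
qed

end
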